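(* For every integer \(n\ge 3\), \[ \operatorname{pf}(K_{n,n})\ge \left\lceil \left(\tfrac83\right)^{\lfloor n/3\rfloor}\right\rceil . \]
   Context: \(K_{n,n}\) is the complete bipartite graph with both sides of size \(n\). For a finite simple graph \(G\) on \(2n\) vertices, assign an independent variable \(x_e\) to each edge \(e\); the perfect-matching polynomial is \(\mathrm{PM}(G)=\sum_{M}\prod_{e\in M}x_e\) over all perfect matchings \(M\). Fix an ordering of the vertices. For an orientation \(D\) of \(G\), the weighted skew-adjacency matrix \(A_D\) has \((A_D)_{ij}=x_{ij}\) if \(ij\) is an edge oriented from \(i\) to \(j\), \(-x_{ij}\) if oriented from \(j\) to \(i\), and \(0\) if \(ij\) is not an edge; \(\mathrm{Pf}(A_D)\) is its Pfaffian. \(G\) is \(k\)-Pfaffian if there exist orientations \(D_1,\dots,D_k\) and reals \(c_1,\dots,c_k\) with \(\mathrm{PM}(G)=\sum_{i=1}^k c_i\,\mathrm{Pf}(A_{D_i})\) as polynomials; the Pfaffian number \(\operatorname{pf}(G)\) is the least positive integer \(k\) such that \(G\) is \(k\)-Pfaffian. *)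

theory Defs
  imports Complex_Main "HOL-Library.Poly_Mapping" "HOL-Combinatorics.Permutations"
begin

text \<open>Real polynomials in the variables \<open>'x\<close>: finitely supported maps from monomials to
  coefficients, with convolution as product.\<close>

type_synonym 'x real_mpoly = "('x \<Rightarrow>\<^sub>0 nat) \<Rightarrow>\<^sub>0 real"

definition Var :: "'x \<Rightarrow> 'x real_mpoly" where
  "Var x = Poly_Mapping.single (Poly_Mapping.single x 1) 1"

definition Const :: "real \<Rightarrow> 'x real_mpoly" where
  "Const c = Poly_Mapping.single 0 c"

type_synonym 'v graph = "'v set \<times> 'v set set"

abbreviation verts :: "'v graph \<Rightarrow> 'v set" where "verts \<equiv> fst"
abbreviation edges :: "'v graph \<Rightarrow> 'v set set" where "edges \<equiv> snd"

definition finite_simple_graph :: "'v graph \<Rightarrow> bool" where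
  "finite_simple_graph G \<longleftrightarrow> finite (verts G) \<and> (\<forall>e\<in>edges G. e \<subseteq> verts G \<and> card e = 2)"

definition complete_bipartite :: "nat \<Rightarrow> nat \<Rightarrow> (nat + nat) graph" where
  "complete_bipartite m n =
     (Inl ` {..<m} \<union> Inr ` {..<n}, {{Inl i, Inr j} | i j. i < m \<and> j < n})"

lemma finite_simple_graph_complete_bipartite: "finite_simple_graph (complete_bipartite m n)"
  by (auto simp: finite_simple_graph_def complete_bipartite_def)

lemma card_verts_complete_bipartite: "card (verts (complete_bipartite m n)) = m + n"
  unfolding complete_bipartite_def
  by (subst fst_conv, subst card_Un_disjoint) (auto simp: card_image)

definition perfect_matching :: "'v graph \<Rightarrow> 'v set set \<Rightarrow> bool" where
  "perfect_matching G M \<longleftrightarrow> M \<subseteq> edges G \<and> (\<forall>v\<in>verts G. \<exists>!e. e \<in> M \<and> v \<in> e)"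

definition PM :: "'v graph \<Rightarrow> 'v set real_mpoly" where
  "PM G = (\<Sum>M | perfect_matching G M. \<Prod>e\<in>M. Var e)"

text \<open>An orientation is the set of its arcs \<open>(u, v)\<close>, directed from \<open>u\<close> to \<open>v\<close>.\<close>

definition orientation :: "'v graph \<Rightarrow> ('v \<times> 'v) set \<Rightarrow> bool" where
  "orientation G D \<longleftrightarrow>
     (\<forall>(u, v)\<in>D. {u, v} \<in> edges G) \<and>
     (\<forall>u v. {u, v} \<in> edges G \<longrightarrow> ((u, v) \<in> D) \<noteq> ((v, u) \<in> D))"

text \<open>The Pfaffian of the skew-symmetric matrix \<open>(A i j)\<close> with \<open>i, j < 2 * m\<close>.  Each partition of
  the index set into pairs is represented by the unique permutation that lists every pair in
  increasing order and the pairs by increasing first element.\<close>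

definition pfaffian :: "nat \<Rightarrow> (nat \<Rightarrow> nat \<Rightarrow> 'a::comm_ring_1) \<Rightarrow> 'a" where
  "pfaffian m A =
     (\<Sum>p | p permutes {..<2 * m} \<and>
            (\<forall>i<m. p (2 * i) < p (2 * i + 1)) \<and>
            (\<forall>i. i + 1 < m \<longrightarrow> p (2 * i) < p (2 * (i + 1))).
        of_int (sign p) * (\<Prod>i<m. A (p (2 * i)) (p (2 * i + 1))))"

text \<open>The ordering of the vertices is a list \<open>vs\<close>; rows and columns are numbered from \<open>0\<close>.\<close>

definition vertex_ordering :: "'v graph \<Rightarrow> 'v list \<Rightarrow> bool" where
  "vertex_ordering G vs \<longleftrightarrow> distinct vs \<and> set vs = verts G"

definition skew_adjacency ::
  "'v list \<Rightarrow> ('v \<times> 'v) set \<Rightarrow> nat \<Rightarrow> nat \<Rightarrow> 'v set real_mpoly" where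
  "skew_adjacency vs D i j =
     (if (vs ! i, vs ! j) \<in> D then Var {vs ! i, vs ! j}
      else if (vs ! j, vs ! i) \<in> D then - Var {vs ! i, vs ! j}
      else 0)"

definition k_pfaffian :: "'v list \<Rightarrow> 'v graph \<Rightarrow> nat \<Rightarrow> bool" where
  "k_pfaffian vs G k \<longleftrightarrow>
     (\<exists>(D :: nat \<Rightarrow> ('v \<times> 'v) set) (c :: nat \<Rightarrow> real).
        (\<forall>i<k. orientation G (D i)) \<and>
        PM G = (\<Sum>i<k. Const (c i) * pfaffian (length vs div 2) (skew_adjacency vs (D i))))"

text \<open>A finite simple graph with an even number of vertices is \<open>k\<close>-Pfaffian for some \<open>k\<close>, and changing the
  ordering \<open>vs\<close> changes all Pfaffians by one common sign, so for such graphs the minimum exists and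
  does not depend on \<open>vs\<close>.\<close>

definition pfaffian_number :: "'v list \<Rightarrow> 'v graph \<Rightarrow> nat" where
  "pfaffian_number vs G = (LEAST k. 0 < k \<and> k_pfaffian vs G k)"

end

theory Submission
  imports Defs "HOL-Library.FuncSet" "HOL-Library.Infinite_Set"
begin

text \<open>A Pfaffian of an orientation of \<open>K\<^bsub>n,n\<^esub>\<close> is, up to a common sign, the determinant of a matrix
  of signed variables, so \<open>K\<^bsub>n,n\<^esub>\<close> is \<open>k\<close>-Pfaffian exactly when the sign function on permutations is
  a combination of \<open>k\<close> functions \<open>\<sigma> \<mapsto> \<Prod>i<n. s i (\<sigma> i)\<close> with \<open>s i j = \<plusminus>1\<close>.  On the permutations
  that preserve \<open>m = n div 3\<close> consecutive blocks of length 3, both sides are tensors of order \<open>m\<close> over the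
  six-element set \<open>S\<^sub>3\<close>; after division by the sign function, the left side is the constant 1, and each
  factor on the right is a \<open>\<plusminus>1\<close> function on \<open>S\<^sub>3\<close> whose product over \<open>S\<^sub>3\<close> is \<open>-1\<close>.  Pair these tensors
  with products of the 32 functions \<open>\<plusminus>1\<close> on \<open>S\<^sub>3\<close> whose product over \<open>S\<^sub>3\<close> is 1.  The constant 1 is
  orthogonal to none of them, since six signs with product 1 do not cancel, whereas each factor is
  orthogonal to all but 12 of them.  Every choice of \<open>m\<close> test functions has to be detected by one of
  the \<open>k\<close> summands, hence \<open>32 ^ m \<le> k * 12 ^ m\<close>.\<close>

section \<open>A bound for tensors of signs\<close>

text \<open>A function with values 1 and -1 is encoded by the set where it is -1. Pointwise products
  become symmetric differences, the sum depends only on the cardinality, and the product only on its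
  parity.\<close>

definition set_sign :: "'a set \<Rightarrow> 'a \<Rightarrow> real" where
  "set_sign S x = (if x \<in> S then - 1 else 1)"

lemma sum_set_sign:
  assumes "finite T" "S \<subseteq> T"
  shows "(\<Sum>x\<in>T. set_sign S x) = real (card T) - 2 * real (card S)"
proof -
  have "(\<Sum>x\<in>T. set_sign S x) = (\<Sum>x\<in>T. 1 - 2 * (if x \<in> S then 1 else 0))"
    by (intro sum.cong) (auto simp: set_sign_def)
  also have "\<dots> = real (card T) - 2 * (\<Sum>x\<in>T. if x \<in> S then 1 else 0)"
    by (simp only: sum_subtractf sum_distrib_left[symmetric]) simp
  also have "(\<Sum>x\<in>T. if x \<in> S then 1 else 0 :: real) = real (card S)"
    using assms by (simp add: sum.If_cases Int_absorb1)
  finally show ?thesis .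
qed

lemma prod_set_sign:
  assumes "finite T" "S \<subseteq> T"
  shows "(\<Prod>x\<in>T. set_sign S x) = (- 1) ^ card S"
  using assms by (simp add: set_sign_def prod.If_cases Int_absorb1)

lemma set_sign_mult: "set_sign S x * set_sign U x = set_sign (sym_diff S U) x"
  by (auto simp: set_sign_def)

lemma even_card_sym_diff:
  assumes "finite S" "finite U"
  shows "even (card (sym_diff S U)) \<longleftrightarrow> even (card S + card U)"
proof -
  have "card (sym_diff S U) = card (S - U) + card (U - S)"
    using assms by (intro card_Un_disjoint) auto
  moreover have "card S = card (S - U) + card (S \<inter> U)"
    using assms card_Diff_subset_Int[of S U] card_mono[of S "S \<inter> U"] by simp
  moreover have "card U = card (U - S) + card (S \<inter> U)"
    using assms card_Diff_subset_Int[of U S] card_mono[of U "S \<inter> U"] by (simp add: Int_commute)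
  ultimately show ?thesis by presburger
qed

lemma card_even_subsets_6:
  assumes "card T = 6"
  shows "card {S. S \<subseteq> T \<and> even (card S)} = 32"
proof -
  have fin: "finite T" using assms card.infinite by fastforce
  have "{S. S \<subseteq> T \<and> even (card S)} = (\<Union>i\<in>{0,2,4,6}. {S. S \<subseteq> T \<and> card S = i})"
  proof (intro set_eqI iffI)
    fix S assume "S \<in> {S. S \<subseteq> T \<and> even (card S)}"
    then have S: "S \<subseteq> T" "even (card S)" by auto
    then have "card S \<le> 6" using card_mono[OF fin S(1)] assms by simp
    with S(2) have "card S = 0 \<or> card S = 2 \<or> card S = 4 \<or> card S = 6" by presburger
    then have "card S \<in> {0,2,4,6}" by simp
    then show "S \<in> (\<Union>i\<in>{0,2,4,6}. {S. S \<subseteq> T \<and> card S = i})" using S by auto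
  qed auto
  also have "card \<dots> = (\<Sum>i\<in>{0,2,4,6}. card {S. S \<subseteq> T \<and> card S = i})"
    using fin by (intro card_UN_disjoint) auto
  also have "\<dots> = (\<Sum>i\<in>{0,2,4,6}. 6 choose i)"
    using fin assms by (intro sum.cong) (auto simp: n_subsets)
  also have "\<dots> = 32" by (simp add: eval_nat_numeral)
  finally show ?thesis .
qed

text \<open>As \<open>S\<close> runs over the even subsets, \<open>sym_diff S U\<close> runs over the odd subsets of \<open>T\<close>, and the sum
  vanishes on the 20 of them that have three elements.\<close>

lemma card_nonorthogonal:
  assumes "card T = 6" "U \<subseteq> T" "odd (card U)"
  shows "card {S. S \<subseteq> T \<and> even (card S) \<and> (\<Sum>x\<in>T. set_sign S x * set_sign U x) \<noteq> 0} \<le> 12"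
    (is "card ?A \<le> 12")
proof -
  have fin: "finite T" using assms card.infinite by fastforce
  let ?B = "{V. V \<subseteq> T \<and> card V = 1} \<union> {V. V \<subseteq> T \<and> card V = 5}"
  have "card ?B = (6 choose 1) + (6 choose 5)"
    using n_subsets[OF fin, of 1] n_subsets[OF fin, of 5] fin assms
    by (subst card_Un_disjoint) auto
  then have cardB: "card ?B = 12" by (simp add: eval_nat_numeral)
  have "sym_diff S U \<in> ?B" if "S \<in> ?A" for S
  proof -
    from that have S: "S \<subseteq> T" "even (card S)" "(\<Sum>x\<in>T. set_sign S x * set_sign U x) \<noteq> 0" by auto
    have fins: "finite S" "finite U" using S assms fin finite_subset by blast+
    have sub: "sym_diff S U \<subseteq> T" using S assms by auto
    have "(\<Sum>x\<in>T. set_sign S x * set_sign U x) = 6 - 2 * real (card (sym_diff S U))"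
      using sum_set_sign[OF fin sub] assms by (simp only: set_sign_mult)
    then have "card (sym_diff S U) \<noteq> 3" using S(3) by auto
    moreover have "odd (card (sym_diff S U))"
      using even_card_sym_diff[OF fins] S(2) assms(3) by simp
    moreover have "card (sym_diff S U) \<le> 6" using card_mono[OF fin sub] assms by simp
    ultimately have "card (sym_diff S U) = 1 \<or> card (sym_diff S U) = 5"
      by presburger
    with sub show ?thesis by blast
  qed
  \<comment> \<open>Taking the symmetric difference with the fixed set \<open>U\<close> is an
    involution.\<close>
  moreover have "inj_on (\<lambda>S. sym_diff S U) ?A" by (rule inj_onI) blast
  moreover have "finite ?B" using fin finite_subset[of ?B "Pow T"] by blast
  ultimately have "card ?A \<le> card ?B" by (intro card_inj_on_le[of "\<lambda>S. sym_diff S U"]) blast+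
  with cardB show ?thesis by simp
qed

text \<open>In the application \<open>T\<close> consists of the six permutations of a block, and
  \<open>U l j\<close> is the set where the \<open>j\<close>-th factor of summand \<open>l\<close>
  is -1. Its odd cardinality expresses that the product of that factor over \<open>T\<close> is
  -1.\<close>

lemma odd_sign_tensor_bound:
  fixes U :: "nat \<Rightarrow> nat \<Rightarrow> 'a set" and c :: "nat \<Rightarrow> real"
  assumes T: "card T = 6"
    and U: "\<And>l j. l < k \<Longrightarrow> j < m \<Longrightarrow> U l j \<subseteq> T \<and> odd (card (U l j))"
    and one: "\<And>t. t \<in> PiE {..<m} (\<lambda>_. T) \<Longrightarrow> (\<Sum>l<k. c l * (\<Prod>j<m. set_sign (U l j) (t j))) = 1"
  shows "32 ^ m \<le> k * 12 ^ m"
proof -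
  have fin: "finite T" using T card.infinite by fastforce
  define E where "E = {S. S \<subseteq> T \<and> even (card S)}"
  define pair where "pair S V = (\<Sum>x\<in>T. set_sign S x * set_sign V x)" for S V
  have finE: "finite E" using fin by (simp add: E_def)
  \<comment> \<open>These are the choices of one even set per block that summand \<open>l\<close>
    detects. The pairing of two product tensors is the product of the blockwise pairings, so none of
    them may vanish.\<close>
  define N where "N l = PiE {..<m} (\<lambda>j. {S \<in> E. pair S (U l j) \<noteq> 0})" for l
  have "\<exists>l<k. \<phi> \<in> N l" if \<phi>: "\<phi> \<in> PiE {..<m} (\<lambda>_. E)" for \<phi>
  proof -
    have \<phi>E: "\<phi> j \<in> E" if "j < m" for j using \<phi> that by auto
    have "(\<Sum>l<k. c l * (\<Prod>j<m. pair (\<phi> j) (U l j))) =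
        (\<Sum>l<k. c l * (\<Sum>t\<in>PiE {..<m} (\<lambda>_. T). \<Prod>j<m. set_sign (\<phi> j) (t j) * set_sign (U l j) (t j)))"
      unfolding pair_def using fin by (simp add: prod_sum_PiE)
    also have "\<dots> = (\<Sum>t\<in>PiE {..<m} (\<lambda>_. T). (\<Prod>j<m. set_sign (\<phi> j) (t j)) *
        (\<Sum>l<k. c l * (\<Prod>j<m. set_sign (U l j) (t j))))"
      by (simp add: sum_distrib_left prod.distrib mult_ac) (rule sum.swap)
    also have "\<dots> = (\<Sum>t\<in>PiE {..<m} (\<lambda>_. T). (\<Prod>j<m. set_sign (\<phi> j) (t j)))"
      using one by (intro sum.cong) auto
    also have "\<dots> = (\<Prod>j<m. \<Sum>x\<in>T. set_sign (\<phi> j) x)"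
      using fin by (simp add: prod_sum_PiE)
    also have "\<dots> \<noteq> 0"
    proof -
      \<comment> \<open>The sum is 6 minus twice the cardinality; it vanishes only for cardinality
        3, which is odd.\<close>
      have "(\<Sum>x\<in>T. set_sign (\<phi> j) x) \<noteq> 0" if "j < m" for j
      proof -
        have "\<phi> j \<subseteq> T" "even (card (\<phi> j))" using \<phi>E[OF that] by (auto simp: E_def)
        moreover from this have "card (\<phi> j) \<noteq> 3" by auto
        ultimately show ?thesis using sum_set_sign[OF fin] T by auto
      qed
      then show ?thesis by auto
    qed
    \<comment> \<open>A nonzero sum has a nonzero summand, and every factor of that summand is
      nonzero.\<close>
    finally obtain l where l: "l < k" "c l * (\<Prod>j<m. pair (\<phi> j) (U l j)) \<noteq> 0"
      by (metis (no_types, lifting) lessThan_iff sum.neutral)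
    then have "pair (\<phi> j) (U l j) \<noteq> 0" if "j < m" for j using that by auto
    then have "\<phi> \<in> N l" using \<phi> by (auto simp: N_def PiE_iff)
    with l show ?thesis by blast
  qed
  then have "PiE {..<m} (\<lambda>_. E) \<subseteq> (\<Union>l<k. N l)" by blast
  moreover have "finite (\<Union>l<k. N l)" using finE by (auto simp: N_def intro!: finite_PiE)
  ultimately have "card (PiE {..<m} (\<lambda>_. E)) \<le> card (\<Union>l<k. N l)" by (rule card_mono[rotated])
  also have "\<dots> \<le> (\<Sum>l<k. card (N l))" by (rule card_UN_le) simp
  also have "\<dots> \<le> (\<Sum>l<k. 12 ^ m)"
  proof (intro sum_mono)
    fix l assume "l \<in> {..<k}"
    then have l: "l < k" by simp
    have "card (N l) = (\<Prod>j<m. card {S \<in> E. pair S (U l j) \<noteq> 0})"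
      by (simp add: N_def card_PiE)
    also have "\<dots> \<le> (\<Prod>j<m. 12)"
    proof (intro prod_mono conjI)
      fix j assume "j \<in> {..<m}"
      then show "card {S \<in> E. pair S (U l j) \<noteq> 0} \<le> 12"
        using card_nonorthogonal[OF T, of "U l j"] U[OF l] by (simp add: E_def pair_def conj_ac)
    qed simp
    finally show "card (N l) \<le> 12 ^ m" by simp
  qed
  finally show ?thesis
    using card_even_subsets_6[OF T] by (simp add: card_PiE E_def)
qed

section \<open>Signs of block permutations\<close>

text \<open>The direct sum of permutations of consecutive intervals of length \<open>d\<close>. It
  is used with \<open>d = 3\<close> for the blocks of the tensor argument and with
  \<open>d = 2\<close> for exchanging the two ends of matching pairs.\<close>

definition block_perm :: "nat \<Rightarrow> nat \<Rightarrow> (nat \<Rightarrow> nat \<Rightarrow> nat) \<Rightarrow> nat \<Rightarrow> nat" where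
  "block_perm d m t x = (if x < d * m then d * (x div d) + t (x div d) (x mod d) else x)"

lemma block_perm_apply: "j < m \<Longrightarrow> a < d \<Longrightarrow> block_perm d m t (d * j + a) = d * j + t j a"
proof -
  assume "j < m" "a < d"
  then have "d * j + a < d * Suc j" "d * Suc j \<le> d * m"
    by (simp_all only: mult_le_mono2 Suc_leI) simp
  then show ?thesis using \<open>a < d\<close> by (simp add: block_perm_def)
qed

text \<open>Induction on the number of blocks: the last block splits off as a copy \<open>g\<close>
  of \<open>t m\<close>, shifted by \<open>d * m\<close>. Shifting preserves the sign, and signs
  multiply under composition.\<close>

lemma block_perm_permutes_sign:
  assumes "\<And>j. j < m \<Longrightarrow> t j permutes {..<d}"
  shows "block_perm d m t permutes {..<d * m} \<and> sign (block_perm d m t) = (\<Prod>j<m. sign (t j))"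
  using assms
proof (induction m)
  case 0
  have "block_perm d 0 t = id" by (simp add: block_perm_def fun_eq_iff)
  then show ?case by (simp add: id_def)
next
  case (Suc m)
  define f where "f a = d * m + a" for a
  define g where "g = map_permutation {..<d} f (t m)"
  have bij: "bij_betw f {..<d} {d * m..<d * Suc m}"
    by (rule bij_betwI[where g = "\<lambda>x. x - d * m"]) (auto simp: f_def)
  then have g: "g permutes {d * m..<d * Suc m}"
    unfolding g_def by (rule map_permutation_permutes) (simp add: Suc.prems)
  have inj: "inj_on f {..<d}" using bij by (rule bij_betw_imp_inj_on)
  have IH: "block_perm d m t permutes {..<d * m}" "sign (block_perm d m t) = (\<Prod>j<m. sign (t j))"
    using Suc by auto
  have eq: "block_perm d (Suc m) t = block_perm d m t \<circ> g"
  proof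
    fix x
    consider "x < d * m" | "x \<in> {d * m..<d * Suc m}" | "x \<ge> d * Suc m" by fastforce
    then show "block_perm d (Suc m) t x = (block_perm d m t \<circ> g) x"
    proof cases
      case 1
      then have "g x = x" using permutes_not_in[OF g] by simp
      then show ?thesis using 1 by (simp add: block_perm_def)
    next
      case 2
      then have "x \<in> f ` {..<d}" using bij by (simp only: bij_betw_def)
      then obtain a where a: "a < d" "x = f a" by blast
      then have "g x = f (t m a)"
        using map_permutation_apply[OF inj, of a] by (simp add: g_def)
      moreover have "block_perm d (Suc m) t x = f (t m a)"
        using a block_perm_apply[of m "Suc m" a d t] by (simp add: f_def)
      ultimately show ?thesis by (simp add: block_perm_def f_def)
    next
      case 3
      then have "g x = x" using permutes_not_in[OF g] by simp
      then show ?thesis using 3 by (simp add: block_perm_def)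
    qed
  qed
  have g': "g permutes {..<d * Suc m}" by (rule permutes_subset[OF g]) auto
  have b': "block_perm d m t permutes {..<d * Suc m}" by (rule permutes_subset[OF IH(1)]) auto
  have "sign g = sign (t m)"
    unfolding g_def using inj Suc.prems by (intro sign_map_permutation) auto
  then have "sign (block_perm d (Suc m) t) = (\<Prod>j<Suc m. sign (t j))"
    unfolding eq using b' g' IH(2)
    by (subst sign_compose) (auto intro: permutes_imp_permutation)
  with permutes_compose[OF g' b'] show ?case unfolding eq by blast
qed

lemmas block_perm_permutes = block_perm_permutes_sign[THEN conjunct1]
lemmas sign_block_perm = block_perm_permutes_sign[THEN conjunct2]

section \<open>Even and odd permutations, and the sign product over a block of length 3\<close>

lemma bij_even_odd_permutations:
  assumes "finite A" "b \<in> A" "c \<in> A" "b \<noteq> c"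
  shows "bij_betw (\<lambda>t. t \<circ> transpose b c) {t. t permutes A \<and> sign t = 1} {t. t permutes A \<and> sign t = - 1}"
proof -
  \<comment> \<open>Composition with a transposition is an involution that reverses the
    sign.\<close>
  have "t \<circ> transpose b c permutes A" "sign (t \<circ> transpose b c) = - sign t" if "t permutes A" for t
  proof -
    have "transpose b c permutes A" using assms by (intro permutes_swap_id)
    with that show "t \<circ> transpose b c permutes A" by (intro permutes_compose)
    show "sign (t \<circ> transpose b c) = - sign t"
      using assms that by (subst sign_compose) (auto simp: sign_swap_id permutation_swap_id intro: permutes_imp_permutation)
  qed
  then show ?thesis
    by (intro bij_betwI[where g = "\<lambda>t. t \<circ> transpose b c"]) (auto simp: comp_assoc)
qed

lemma permutations_split_sign:
  "{t. t permutes A} = {t. t permutes A \<and> sign t = 1} \<union> {t. t permutes A \<and> sign t = - 1}"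
  using sign_cases by auto

text \<open>Every entry of a \<open>3 \<times> 3\<close> matrix lies on exactly one even and one odd permutation.\<close>

lemma prod_permutations_3:
  fixes s :: "nat \<Rightarrow> nat \<Rightarrow> real"
  assumes s: "\<And>a b. a < 3 \<Longrightarrow> b < 3 \<Longrightarrow> s a b \<in> {1, - 1}"
  shows "(\<Prod>t | t permutes {..<3}. sign t * (\<Prod>a<3. s a (t a))) = - 1"
proof -
  define E where "E = {t. t permutes {..<3::nat} \<and> sign t = 1}"
  define O' where "O' = {t. t permutes {..<3::nat} \<and> sign t = - 1}"
  have split: "{t. t permutes {..<3}} = E \<union> O'" "E \<inter> O' = {}"
    using permutations_split_sign[of "{..<3}"] by (auto simp: E_def O'_def)
  have fin: "finite {t. t permutes {..<3::nat}}" by (simp add: finite_permutations)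
  then have finEO: "finite E" "finite O'" by (simp_all add: E_def O'_def)
  have bij: "bij_betw (\<lambda>t. t \<circ> transpose b c) E O'" if "b < 3" "c < 3" "b \<noteq> c" for b c
    unfolding E_def O'_def using that by (intro bij_even_odd_permutations) auto
  have "card E = card O'" using bij_betw_same_card[OF bij[of 0 1]] by simp
  moreover have "card E + card O' = 6"
    using card_permutations[of "{..<3::nat}" 3] finEO split
    by (simp add: card_Un_disjoint[symmetric] eval_nat_numeral)
  ultimately have cardO: "card O' = 3" by simp
  \<comment> \<open>The three odd permutations make the product of the signs -1; the entries of
    \<open>s\<close> will contribute 1.\<close>
  have sgn: "(\<Prod>t | t permutes {..<3::nat}. real_of_int (sign t)) = - 1"
    unfolding split using finEO split(2) cardO
    by (subst prod.union_disjoint) (auto simp: E_def O'_def)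
  have one: "(\<Prod>t | t permutes {..<3}. s a (t a)) = 1" if a: "a < 3" for a
  proof -
    \<comment> \<open>Exchanging the two rows other than \<open>a\<close> matches even with odd
      permutations that take the same value at \<open>a\<close>, so each entry of row
      \<open>a\<close> is paired with itself and contributes a square.\<close>
    obtain b c where bc: "b < 3" "c < 3" "b \<noteq> c" "b \<noteq> a" "c \<noteq> a"
    proof -
      have "a = 0 \<or> a = 1 \<or> a = 2" using a by auto
      then show ?thesis using that[of 1 2] that[of 0 2] that[of 0 1] by auto
    qed
    have "(\<Prod>t\<in>O'. s a (t a)) = (\<Prod>t\<in>E. s a ((t \<circ> transpose b c) a))"
      by (rule prod.reindex_bij_betw[symmetric]) (rule bij[OF bc(1,2,3)])
    also have "\<dots> = (\<Prod>t\<in>E. s a (t a))" using bc by (simp add: transpose_def)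
    finally have "(\<Prod>t | t permutes {..<3}. s a (t a)) = (\<Prod>t\<in>E. s a (t a) * s a (t a))"
      unfolding split using finEO split(2)
      by (subst prod.union_disjoint) (simp_all add: prod.distrib)
    also have "\<dots> = 1"
    proof (intro prod.neutral ballI)
      fix t assume "t \<in> E"
      then have "t permutes {..<3}" by (simp add: E_def)
      then have "t a < 3" using a permutes_in_image by fastforce
      then show "s a (t a) * s a (t a) = 1" using s[OF a, of "t a"] by auto
    qed
    finally show ?thesis .
  qed
  have "(\<Prod>t | t permutes {..<3}. \<Prod>a<3. s a (t a)) = 1"
    by (subst prod.swap) (simp add: one)
  then show ?thesis using sgn by (simp add: prod.distrib)
qed

section \<open>Pfaffians of bipartite matrices\<close>

text \<open>Left vertices carry the numbers 2 * i and right vertices 2 * i + 1, so this is \<alpha>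
  on the left side together with \<beta> on the right side.\<close>

definition interleave :: "nat \<Rightarrow> (nat \<Rightarrow> nat) \<Rightarrow> (nat \<Rightarrow> nat) \<Rightarrow> nat \<Rightarrow> nat" where
  "interleave n \<alpha> \<beta> x =
     (if x < 2 * n then if even x then 2 * \<alpha> (x div 2) else 2 * \<beta> (x div 2) + 1 else x)"

text \<open>The even and the odd numbers below 2 * n are disjoint, so the map is the composition of
  a copy of \<alpha> and a copy of \<beta>, and the signs multiply.\<close>

lemma interleave_permutes_sign:
  assumes "\<alpha> permutes {..<n}" "\<beta> permutes {..<n}"
  shows "interleave n \<alpha> \<beta> permutes {..<2 * n} \<and> sign (interleave n \<alpha> \<beta>) = sign \<alpha> * sign \<beta>"
proof -
  define a where "a = map_permutation {..<n} (\<lambda>i. 2 * i) \<alpha>"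
  define b where "b = map_permutation {..<n} (\<lambda>i. 2 * i + 1) \<beta>"
  have inj: "inj_on (\<lambda>i. 2 * i) {..<n}" "inj_on (\<lambda>i. 2 * i + 1) {..<n}"
    by (auto intro: inj_onI)
  have a: "a permutes (\<lambda>i. 2 * i) ` {..<n}" and b: "b permutes (\<lambda>i. 2 * i + 1) ` {..<n}"
    unfolding a_def b_def
    using assms inj by (intro map_permutation_permutes inj_on_imp_bij_betw; simp)+
  have a': "a permutes {..<2 * n}" and b': "b permutes {..<2 * n}"
    by (rule permutes_subset[OF a], fastforce, rule permutes_subset[OF b], fastforce)
  have "interleave n \<alpha> \<beta> = a \<circ> b"
  proof
    fix x
    consider (out) "x \<ge> 2 * n" | (ev) i where "i < n" "x = 2 * i" | (od) i where "i < n" "x = 2 * i + 1"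
    proof (cases "x < 2 * n")
      case True
      then have "x div 2 < n" by simp
      with that(2,3)[of "x div 2"] show ?thesis by (cases "even x") auto
    qed (use that(1) in simp)
    then show "interleave n \<alpha> \<beta> x = (a \<circ> b) x"
    proof cases
      case out
      then show ?thesis using a' b' by (simp add: interleave_def permutes_not_in)
    next
      case (ev i)
      then have "b x = x" by (intro permutes_not_in[OF b]) (auto, presburger)
      then show ?thesis
        using map_permutation_apply[OF inj(1), of i \<alpha>] ev by (simp add: a_def interleave_def)
    next
      case (od i)
      have "\<beta> i < n" using od assms(2) permutes_in_image by fastforce
      have "b x = 2 * \<beta> i + 1"
        using map_permutation_apply[OF inj(2), of i \<beta>] od by (simp add: b_def)
      moreover have "a (2 * \<beta> i + 1) = 2 * \<beta> i + 1"
        by (intro permutes_not_in[OF a]) (auto, presburger)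
      ultimately show ?thesis using od by (simp add: interleave_def)
    qed
  qed
  moreover have "sign a = sign \<alpha>" "sign b = sign \<beta>"
    unfolding a_def b_def using inj assms by (auto intro!: sign_map_permutation)
  ultimately show ?thesis
    using permutes_compose[OF b' a'] sign_compose[of a b]
      permutes_imp_permutation[OF finite_lessThan a'] permutes_imp_permutation[OF finite_lessThan b']
    by simp
qed

text \<open>Here \<open>q (2 * i)\<close> is the index of the \<open>i\<close>-th left vertex and \<open>q (2 * i + 1)\<close> that of the \<open>i\<close>-th right
  vertex.  The permutation below lists the matching that pairs the left vertex \<open>\<tau> i\<close> with the
  right vertex \<open>\<rho> i\<close>, in the order of the indices \<open>i\<close>, with the two ends of the pair exchanged when
  \<open>f i\<close> holds.\<close>

definition pair_listing ::
    "nat \<Rightarrow> (nat \<Rightarrow> nat) \<Rightarrow> (nat \<Rightarrow> nat) \<Rightarrow> (nat \<Rightarrow> nat) \<Rightarrow> (nat \<Rightarrow> bool) \<Rightarrow> nat \<Rightarrow> nat" where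
  "pair_listing n q \<tau> \<rho> f =
     q \<circ> interleave n \<tau> \<rho> \<circ> block_perm 2 n (\<lambda>i. if f i then transpose 0 1 else id)"

context
  fixes n :: nat and q \<tau> \<rho> :: "nat \<Rightarrow> nat" and f :: "nat \<Rightarrow> bool"
  assumes perms: "q permutes {..<2 * n}" "\<tau> permutes {..<n}" "\<rho> permutes {..<n}"
begin

private lemma swaps: "(if f i then transpose 0 1 else id) permutes {..<2::nat}"
  by (simp add: permutes_swap_id permutes_id del: id_apply)

lemma pair_listing_permutes: "pair_listing n q \<tau> \<rho> f permutes {..<2 * n}"
  unfolding pair_listing_def
  using perms interleave_permutes_sign[OF perms(2,3)] swaps
  by (intro permutes_compose block_perm_permutes) auto

lemma sign_pair_listing:
  "sign (pair_listing n q \<tau> \<rho> f) = sign q * sign \<tau> * sign \<rho> * (\<Prod>i<n. if f i then - 1 else 1)"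
proof -
  define b where "b = block_perm 2 n (\<lambda>i. if f i then transpose 0 1 else id)"
  have b: "b permutes {..<2 * n}" unfolding b_def using swaps by (intro block_perm_permutes)
  have "sign b = (\<Prod>i<n. sign (if f i then transpose 0 1 else id :: nat \<Rightarrow> nat))"
    unfolding b_def using swaps by (intro sign_block_perm)
  also have "\<dots> = (\<Prod>i<n. if f i then - 1 else 1)"
    by (intro prod.cong) (auto simp: sign_swap_id)
  finally have sb: "sign b = (\<Prod>i<n. if f i then - 1 else 1)" .
  note i = interleave_permutes_sign[OF perms(2,3)]
  have "permutation q" "permutation (interleave n \<tau> \<rho>)" "permutation b"
    using perms b i by (auto intro: permutes_imp_permutation)
  then show ?thesis
    unfolding pair_listing_def b_def[symmetric]
    using i sb by (simp add: sign_compose permutation_compose)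
qed

lemma pair_listing_apply:
  assumes "i < n"
  shows "pair_listing n q \<tau> \<rho> f (2 * i) = q (if f i then 2 * \<rho> i + 1 else 2 * \<tau> i)"
    and "pair_listing n q \<tau> \<rho> f (2 * i + 1) = q (if f i then 2 * \<tau> i else 2 * \<rho> i + 1)"
  using assms block_perm_apply[of i n 0 2] block_perm_apply[of i n 1 2]
  by (auto simp: pair_listing_def interleave_def)

end

section \<open>Sorted listings of bipartite matchings\<close>

definition pair_sorted :: "nat \<Rightarrow> (nat \<Rightarrow> nat) \<Rightarrow> bool" where
  "pair_sorted n p \<longleftrightarrow> p permutes {..<2 * n} \<and>
     (\<forall>i<n. p (2 * i) < p (2 * i + 1)) \<and> (\<forall>i. i + 1 < n \<longrightarrow> p (2 * i) < p (2 * (i + 1)))"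

lemma pair_sorted_strict_mono:
  assumes "pair_sorted n p" "i < j" "j < n"
  shows "p (2 * i) < p (2 * j)"
  using assms(2,3)
proof (induction j rule: less_induct)
  case (less j)
  then obtain j' where j: "j = Suc j'" by (cases j) auto
  have "p (2 * j') < p (2 * (j' + 1))" using assms(1) less.prems j by (simp add: pair_sorted_def)
  moreover have "i = j' \<or> i < j'" using less.prems j by linarith
  ultimately show ?case using less.IH[of j'] less.prems j by auto
qed

lemma eq_on_pairs:
  fixes p p' :: "nat \<Rightarrow> nat"
  assumes "p permutes {..<2 * n}" "p' permutes {..<2 * n}"
    and "\<And>i. i < n \<Longrightarrow> p (2 * i) = p' (2 * i) \<and> p (2 * i + 1) = p' (2 * i + 1)"
  shows "p = p'"
proof
  fix x show "p x = p' x"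
  proof (cases "x < 2 * n")
    case True
    then have "x div 2 < n" by simp
    from assms(3)[OF this] show ?thesis by (cases "even x") auto
  next
    case False
    then show ?thesis using assms(1,2) by (simp add: permutes_not_in)
  qed
qed

context
  fixes n :: nat and q :: "nat \<Rightarrow> nat"
  assumes q: "q permutes {..<2 * n}"
begin

private lemma q_eq: "q x = q y \<longleftrightarrow> x = y"
  using permutes_inj[OF q] by (auto dest: injD)

text \<open>The pairs of a matching are disjoint, so their smaller indices differ and can serve as
  sorting keys. Coincidences between a left and a right number are excluded by parity.\<close>

private lemma inj_min_pair:
  assumes \<sigma>: "\<sigma> permutes {..<n}"
  shows "inj (\<lambda>i. min (q (2 * i)) (q (2 * \<sigma> i + 1)))"
proof (rule injI)
  have \<sigma>_eq: "\<sigma> x = \<sigma> y \<longleftrightarrow> x = y" for x y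
    using permutes_inj[OF \<sigma>] by (auto dest: injD)
  fix i j assume "min (q (2 * i)) (q (2 * \<sigma> i + 1)) = min (q (2 * j)) (q (2 * \<sigma> j + 1))"
  then have "q (2 * i) = q (2 * j) \<or> q (2 * i) = q (2 * \<sigma> j + 1) \<or>
      q (2 * \<sigma> i + 1) = q (2 * j) \<or> q (2 * \<sigma> i + 1) = q (2 * \<sigma> j + 1)"
    unfolding min_def by (auto split: if_splits)
  then show "i = j" by (simp add: q_eq \<sigma>_eq) presburger
qed

text \<open>Increasing order of the minima determines \<tau>, and increasing order within each pair
  determines which end comes first. The conclusion equates the listings, not \<open>f\<close> and
  \<open>f'\<close>, which may differ from \<open>n\<close> on.\<close>

lemma pair_sorted_listing_unique:
  assumes \<sigma>: "\<sigma> permutes {..<n}" and \<tau>: "\<tau> permutes {..<n}" and \<tau>': "\<tau>' permutes {..<n}"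
    and s: "pair_sorted n (pair_listing n q \<tau> (\<sigma> \<circ> \<tau>) f)" "pair_sorted n (pair_listing n q \<tau>' (\<sigma> \<circ> \<tau>') f')"
  shows "pair_listing n q \<tau> (\<sigma> \<circ> \<tau>) f = pair_listing n q \<tau>' (\<sigma> \<circ> \<tau>') f'"
proof -
  define m where "m i = min (q (2 * i)) (q (2 * \<sigma> i + 1))" for i
  define M where "M i = max (q (2 * i)) (q (2 * \<sigma> i + 1))" for i
  have m_inj: "inj m" using inj_min_pair[OF \<sigma>] by (simp add: m_def[abs_def])
  \<comment> \<open>Whatever \<open>f\<close> is, sortedness puts the minimum of the pair first and
    its maximum second.\<close>
  have vals: "pair_listing n q \<tau> (\<sigma> \<circ> \<tau>) f (2 * i) = m (\<tau> i)" 
      "pair_listing n q \<tau> (\<sigma> \<circ> \<tau>) f (2 * i + 1) = M (\<tau> i)"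
    if "i < n" "\<tau> permutes {..<n}" "pair_sorted n (pair_listing n q \<tau> (\<sigma> \<circ> \<tau>) f)" for i \<tau> f
  proof -
    note pl = pair_listing_apply[OF q that(2) permutes_compose[OF that(2) \<sigma>] that(1), of f]
    from that have "pair_listing n q \<tau> (\<sigma> \<circ> \<tau>) f (2 * i) < pair_listing n q \<tau> (\<sigma> \<circ> \<tau>) f (2 * i + 1)"
      by (simp add: pair_sorted_def)
    then show "pair_listing n q \<tau> (\<sigma> \<circ> \<tau>) f (2 * i) = m (\<tau> i)"
        "pair_listing n q \<tau> (\<sigma> \<circ> \<tau>) f (2 * i + 1) = M (\<tau> i)"
      unfolding pl by (auto simp: m_def M_def split: if_splits)
  qed
  have sorted: "sorted (map (\<lambda>i. m (\<tau> i)) [0..<n])" "set (map (\<lambda>i. m (\<tau> i)) [0..<n]) = m ` {..<n}"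
      "distinct (map (\<lambda>i. m (\<tau> i)) [0..<n])"
    if \<tau>: "\<tau> permutes {..<n}" and s: "pair_sorted n (pair_listing n q \<tau> (\<sigma> \<circ> \<tau>) f)" for \<tau> f
  proof -
    have "m (\<tau> i) < m (\<tau> j)" if "i < j" "j < n" for i j
      using pair_sorted_strict_mono[OF s that] vals(1)[OF _ \<tau> s] that
      by simp
    then show "sorted (map (\<lambda>i. m (\<tau> i)) [0..<n])"
      by (auto simp: sorted_iff_nth_mono_less intro: less_imp_le)
    have "set (map (\<lambda>i. m (\<tau> i)) [0..<n]) = m ` \<tau> ` {..<n}" by auto
    then show "set (map (\<lambda>i. m (\<tau> i)) [0..<n]) = m ` {..<n}"
      by (simp only: permutes_image[OF \<tau>])
    have "inj (\<lambda>i. m (\<tau> i))"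
      using inj_compose[OF m_inj permutes_inj[OF \<tau>]] by (simp only: comp_def)
    then show "distinct (map (\<lambda>i. m (\<tau> i)) [0..<n])"
      unfolding distinct_map by (blast intro: distinct_upt inj_on_subset)
  qed
  \<comment> \<open>Both lists enumerate the same set of minima in increasing order without
    repetition.\<close>
  have "map (\<lambda>i. m (\<tau> i)) [0..<n] = map (\<lambda>i. m (\<tau>' i)) [0..<n]"
    using sorted[OF \<tau> s(1)] sorted[OF \<tau>' s(2)] by (intro sorted_distinct_set_unique) auto
  then have "\<tau> i = \<tau>' i" if "i < n" for i
    using that m_inj by (auto dest: injD)
  then show ?thesis
    using vals[OF _ \<tau> s(1)] vals[OF _ \<tau>' s(2)] s by (intro eq_on_pairs[of _ n]) (auto simp: pair_sorted_def)
qed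

lemma pair_sorted_listing_exists:
  assumes \<sigma>: "\<sigma> permutes {..<n}"
  shows "\<exists>\<tau> f. \<tau> permutes {..<n} \<and> pair_sorted n (pair_listing n q \<tau> (\<sigma> \<circ> \<tau>) f)"
proof -
  define m where "m i = min (q (2 * i)) (q (2 * \<sigma> i + 1))" for i
  have m_inj: "inj_on m {..<n}"
    using inj_min_pair[OF \<sigma>] by (auto simp: m_def[abs_def] intro: inj_on_subset)
  obtain h where h: "bij_betw h {..<card (m ` {..<n})} (m ` {..<n})" "strict_mono_on {..<card (m ` {..<n})} h"
    using ex_bij_betw_strict_mono_card[of "m ` {..<n}"] by blast
  have card: "card (m ` {..<n}) = n" using m_inj by (simp add: card_image)
  \<comment> \<open>\<open>h\<close> enumerates the minima increasingly, so \<tau> sends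
    \<open>i\<close> to the left vertex whose pair has the \<open>i\<close>-th smallest
    minimum.\<close>
  define \<tau> where "\<tau> i = (if i < n then inv_into {..<n} m (h i) else i)" for i
  have "bij_betw (inv_into {..<n} m \<circ> h) {..<n} {..<n}"
    using h(1) m_inj card by (intro bij_betw_trans[OF _ bij_betw_inv_into]) (auto simp: bij_betw_def)
  then have "bij_betw \<tau> {..<n} {..<n}"
    by (subst bij_betw_cong[where g = "inv_into {..<n} m \<circ> h"]) (auto simp: \<tau>_def)
  then have \<tau>: "\<tau> permutes {..<n}" by (rule bij_imp_permutes) (simp add: \<tau>_def)
  have m\<tau>: "m (\<tau> i) = h i" if "i < n" for i
    using that h(1) card by (auto simp: \<tau>_def bij_betw_def intro!: f_inv_into_f)
  \<comment> \<open>The ends are exchanged exactly when the right vertex has the smaller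
    index.\<close>
  define f where "f i \<longleftrightarrow> q (2 * \<sigma> (\<tau> i) + 1) < q (2 * \<tau> i)" for i
  have ne: "q (2 * \<sigma> j + 1) \<noteq> q (2 * j)" for j by (simp add: q_eq) presburger
  note pl = pair_listing_apply[OF q \<tau> permutes_compose[OF \<tau> \<sigma>], of _ f]
  have "pair_listing n q \<tau> (\<sigma> \<circ> \<tau>) f (2 * i) < pair_listing n q \<tau> (\<sigma> \<circ> \<tau>) f (2 * i + 1)" if "i < n" for i
    unfolding pl[OF that] using ne[of "\<tau> i"] by (auto simp: f_def)
  moreover have "pair_listing n q \<tau> (\<sigma> \<circ> \<tau>) f (2 * i) < pair_listing n q \<tau> (\<sigma> \<circ> \<tau>) f (2 * (i + 1))"
    if "i + 1 < n" for i
  proof -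
    have val: "pair_listing n q \<tau> (\<sigma> \<circ> \<tau>) f (2 * i) = h i" if "i < n" for i
      unfolding pl[OF that] m\<tau>[OF that, symmetric] by (auto simp: f_def m_def)
    have "h i < h (i + 1)" using h(2) that card by (auto simp: strict_mono_on_def)
    then show ?thesis using that by (simp only: val)
  qed
  ultimately have "pair_sorted n (pair_listing n q \<tau> (\<sigma> \<circ> \<tau>) f)"
    unfolding pair_sorted_def
    using pair_listing_permutes[OF q \<tau> permutes_compose[OF \<tau> \<sigma>]] by blast
  with \<tau> show ?thesis by blast
qed

text \<open>A listing determines its matching: the pair that contains the left vertex
  \<open>q (2 * i)\<close> also contains its partner.\<close>

lemma pair_listing_matching_unique:
  assumes perms: "\<sigma> permutes {..<n}" "\<tau> permutes {..<n}" "\<sigma>' permutes {..<n}" "\<tau>' permutes {..<n}"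
    and eq: "pair_listing n q \<tau> (\<sigma> \<circ> \<tau>) f = pair_listing n q \<tau>' (\<sigma>' \<circ> \<tau>') f'"
  shows "\<sigma> = \<sigma>'"
proof
  fix i
  show "\<sigma> i = \<sigma>' i"
  proof (cases "i < n")
    case False
    then show ?thesis using perms(1,3) by (simp add: permutes_not_in)
  next
    case True
    have ex: "\<exists>j<n. i = \<tau> j" if "\<tau> permutes {..<n}" for \<tau>
      using permutes_image[OF that] True by (metis imageE lessThan_iff)
    obtain j where j: "j < n" "i = \<tau> j" using ex[OF perms(2)] by blast
    obtain j' where j': "j' < n" "i = \<tau>' j'" using ex[OF perms(4)] by blast
    define P where "P = pair_listing n q \<tau> (\<sigma> \<circ> \<tau>) f"
    have P: "P = pair_listing n q \<tau>' (\<sigma>' \<circ> \<tau>') f'" by (simp add: P_def eq)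
    have "P permutes {..<2 * n}"
      unfolding P_def using q perms by (intro pair_listing_permutes permutes_compose)
    then have Peq: "P x = P y \<longleftrightarrow> x = y" for x y
      using permutes_inj by (auto dest: injD)
    have 1: "{P (2 * j), P (2 * j + 1)} = {q (2 * i), q (2 * \<sigma> i + 1)}"
      unfolding P_def pair_listing_apply[OF q perms(2) permutes_compose[OF perms(2,1)] j(1)]
      using j by auto
    have 2: "{P (2 * j'), P (2 * j' + 1)} = {q (2 * i), q (2 * \<sigma>' i + 1)}"
      unfolding P pair_listing_apply[OF q perms(4) permutes_compose[OF perms(4,3)] j'(1)]
      using j' by auto
    \<comment> \<open>Both pairs contain \<open>q (2 * i)\<close>; since \<open>P\<close> is
      injective, they sit at the same place.\<close>
    have "{P (2 * j), P (2 * j + 1)} \<inter> {P (2 * j'), P (2 * j' + 1)} \<noteq> {}"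
      unfolding 1 2 by blast
    then have "P (2 * j) = P (2 * j') \<or> P (2 * j) = P (2 * j' + 1) \<or>
        P (2 * j + 1) = P (2 * j') \<or> P (2 * j + 1) = P (2 * j' + 1)"
      by blast
    then have "j = j'" unfolding Peq by presburger
    with 1 2 have "{q (2 * i), q (2 * \<sigma> i + 1)} = {q (2 * i), q (2 * \<sigma>' i + 1)}" by simp
    then have "2 * \<sigma> i + 1 = 2 * \<sigma>' i + 1 \<or> 2 * i = 2 * \<sigma>' i + 1"
      unfolding doubleton_eq_iff q_eq by blast
    then show ?thesis by presburger
  qed
qed

text \<open>When every pair joins an even to an odd number, \<tau> can be read off from the left
  ends, \<rho> from the right ends and \<open>f\<close> from the order within the pairs. The
  matching is then \<rho> after the inverse of \<tau>.\<close>

lemma pair_listing_surj: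
  assumes p: "p permutes {..<2 * n}"
    and bip: "\<And>i. i < n \<Longrightarrow> even (inv q (p (2 * i))) \<noteq> even (inv q (p (2 * i + 1)))"
  shows "\<exists>\<sigma> \<tau> f. \<sigma> permutes {..<n} \<and> \<tau> permutes {..<n} \<and> p = pair_listing n q \<tau> (\<sigma> \<circ> \<tau>) f"
proof -
  define r where "r = inv q \<circ> p"
  have r: "r permutes {..<2 * n}" unfolding r_def using p q by (intro permutes_compose permutes_inv)
  have req: "r x = r y \<longleftrightarrow> x = y" for x y
    using permutes_inj[OF r] by (auto dest: injD)
  have r_less: "r x < 2 * n" if "x < 2 * n" for x
    using permutes_in_image[OF r, of x] that by simp
  have p_eq: "p x = q (r x)" for x
    using permutes_inverses[OF q] by (simp add: r_def)
  define f where "f i \<longleftrightarrow> odd (r (2 * i))" for i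
  define \<tau> where "\<tau> i = (if i < n then (if f i then r (2 * i + 1) else r (2 * i)) div 2 else i)" for i
  define \<rho> where "\<rho> i = (if i < n then (if f i then r (2 * i) else r (2 * i + 1)) div 2 else i)" for i
  have par: "odd (r (2 * i + 1)) \<longleftrightarrow> \<not> f i" if "i < n" for i
    using bip[OF that] by (simp add: f_def r_def)
  have \<tau>2: "2 * \<tau> i = (if f i then r (2 * i + 1) else r (2 * i))" if "i < n" for i
    using par[OF that] that by (auto simp: \<tau>_def f_def)
  have \<rho>2: "2 * \<rho> i + 1 = (if f i then r (2 * i) else r (2 * i + 1))" if "i < n" for i
    using par[OF that] that by (auto simp: \<rho>_def f_def)
  have \<tau>: "\<tau> permutes {..<n}"
  proof (rule inj_imp_permutes)
    show "inj_on \<tau> {..<n}"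
    proof (rule inj_onI)
      fix i j assume ij: "i \<in> {..<n}" "j \<in> {..<n}" "\<tau> i = \<tau> j"
      then have "r (2 * i + 1) = r (2 * j + 1) \<or> r (2 * i + 1) = r (2 * j) \<or>
          r (2 * i) = r (2 * j + 1) \<or> r (2 * i) = r (2 * j)"
        using \<tau>2[of i] \<tau>2[of j] by (auto split: if_splits)
      then show "i = j" unfolding req by presburger
    qed
    show "\<tau> i \<in> {..<n}" if "i \<in> {..<n}" for i
      using \<tau>2[of i] that r_less[of "2 * i"] r_less[of "2 * i + 1"] by (auto split: if_splits)
  qed (auto simp: \<tau>_def)
  have \<rho>: "\<rho> permutes {..<n}"
  proof (rule inj_imp_permutes)
    show "inj_on \<rho> {..<n}"
    proof (rule inj_onI)
      fix i j assume ij: "i \<in> {..<n}" "j \<in> {..<n}" "\<rho> i = \<rho> j"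
      then have "r (2 * i + 1) = r (2 * j + 1) \<or> r (2 * i + 1) = r (2 * j) \<or>
          r (2 * i) = r (2 * j + 1) \<or> r (2 * i) = r (2 * j)"
        using \<rho>2[of i] \<rho>2[of j] by (auto split: if_splits)
      then show "i = j" unfolding req by presburger
    qed
    show "\<rho> i \<in> {..<n}" if "i \<in> {..<n}" for i
      using \<rho>2[of i] that r_less[of "2 * i"] r_less[of "2 * i + 1"] by (auto split: if_splits)
  qed (auto simp: \<rho>_def)
  define \<sigma> where "\<sigma> = \<rho> \<circ> inv \<tau>"
  have \<sigma>: "\<sigma> permutes {..<n}" unfolding \<sigma>_def using \<tau> \<rho> by (intro permutes_compose permutes_inv)
  have "\<sigma> \<circ> \<tau> = \<rho>" using permutes_inverses[OF \<tau>] by (auto simp: \<sigma>_def fun_eq_iff)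
  moreover have "p = pair_listing n q \<tau> \<rho> f"
  proof (rule eq_on_pairs[OF p pair_listing_permutes[OF q \<tau> \<rho>]])
    fix i assume i: "i < n"
    show "p (2 * i) = pair_listing n q \<tau> \<rho> f (2 * i) \<and> p (2 * i + 1) = pair_listing n q \<tau> \<rho> f (2 * i + 1)"
      unfolding pair_listing_apply[OF q \<tau> \<rho> i] \<tau>2[OF i] \<rho>2[OF i] p_eq by simp
  qed
  ultimately show ?thesis using \<sigma> \<tau> by metis
qed

text \<open>Up to the sign of \<open>q\<close>, the Pfaffian is the determinant of the block with
  left rows and right columns. Sorted listings that pair two vertices on the same side contribute 0,
  and the others correspond to permutations.\<close>

lemma pfaffian_bipartite:
  fixes A :: "nat \<Rightarrow> nat \<Rightarrow> 'a::comm_ring_1"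
  assumes skew: "\<And>i j. A j i = - A i j"
    and left: "\<And>i j. i < n \<Longrightarrow> j < n \<Longrightarrow> A (q (2 * i)) (q (2 * j)) = 0"
    and right: "\<And>i j. i < n \<Longrightarrow> j < n \<Longrightarrow> A (q (2 * i + 1)) (q (2 * j + 1)) = 0"
  shows "pfaffian n A = of_int (sign q) *
    (\<Sum>\<sigma> | \<sigma> permutes {..<n}. of_int (sign \<sigma>) * (\<Prod>i<n. A (q (2 * i)) (q (2 * \<sigma> i + 1))))"
proof -
  \<comment> \<open>\<open>C\<close> is the index set of the Pfaffian sum, and \<open>B\<close>
    keeps the listings whose pairs all join left to right.\<close>
  define C where "C = {p. pair_sorted n p}"
  define B where "B = {p \<in> C. \<forall>i<n. even (inv q (p (2 * i))) \<noteq> even (inv q (p (2 * i + 1)))}"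
  define F where "F p = of_int (sign p) * (\<Prod>i<n. A (p (2 * i)) (p (2 * i + 1)))" for p
  have finC: "finite C"
    by (rule finite_subset[OF _ finite_permutations[of "{..<2 * n}"]]) (auto simp: C_def pair_sorted_def)
  have "pfaffian n A = sum F C"
    by (simp add: pfaffian_def F_def C_def pair_sorted_def)
  also have "\<dots> = sum F B"
  proof (rule sum.mono_neutral_right[OF finC])
    show "\<forall>p\<in>C - B. F p = 0"
    proof
      fix p assume p: "p \<in> C - B"
      then obtain i where i: "i < n" "even (inv q (p (2 * i))) = even (inv q (p (2 * i + 1)))"
        by (auto simp: B_def)
      have "p permutes {..<2 * n}" using p by (simp add: C_def pair_sorted_def)
      then have "inv q \<circ> p permutes {..<2 * n}" using q by (intro permutes_compose permutes_inv)
      then have lt: "inv q (p x) < 2 * n" if "x < 2 * n" for x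
        using permutes_in_image[of "inv q \<circ> p" "{..<2 * n}" x] that by simp
      define x y where "x = inv q (p (2 * i))" and "y = inv q (p (2 * i + 1))"
      have xy: "x < 2 * n" "y < 2 * n" "even x = even y" "p (2 * i) = q x" "p (2 * i + 1) = q y"
        using i lt[of "2 * i"] lt[of "2 * i + 1"] permutes_inverses[OF q] by (auto simp: x_def y_def)
      have "A (q x) (q y) = 0"
      proof (cases "even x")
        case True
        then show ?thesis using xy left[of "x div 2" "y div 2"] by simp
      next
        case False
        then show ?thesis using xy right[of "x div 2" "y div 2"] by simp
      qed
      then have "A (p (2 * i)) (p (2 * i + 1)) = 0" by (simp only: xy)
      then have "(\<Prod>i<n. A (p (2 * i)) (p (2 * i + 1))) = 0"
        using i(1) by (intro prod_zero) auto
      then show "F p = 0" by (simp add: F_def)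
    qed
  qed (auto simp: B_def)
  also have "\<dots> = (\<Sum>\<sigma> | \<sigma> permutes {..<n}.
      of_int (sign q) * (of_int (sign \<sigma>) * (\<Prod>i<n. A (q (2 * i)) (q (2 * \<sigma> i + 1)))))"
    (is "_ = sum ?G ?S")
  proof -
    have "\<forall>\<sigma>\<in>?S. \<exists>p \<tau> f. \<tau> permutes {..<n} \<and> p = pair_listing n q \<tau> (\<sigma> \<circ> \<tau>) f \<and> p \<in> C"
      using pair_sorted_listing_exists by (fastforce simp: C_def)
    then obtain h where h: "\<forall>\<sigma>\<in>?S. \<exists>\<tau> f. \<tau> permutes {..<n} \<and> h \<sigma> = pair_listing n q \<tau> (\<sigma> \<circ> \<tau>) f \<and> h \<sigma> \<in> C"
      by metis
    have hE: "\<exists>\<tau> f. \<tau> permutes {..<n} \<and> h \<sigma> = pair_listing n q \<tau> (\<sigma> \<circ> \<tau>) f \<and> h \<sigma> \<in> C" if "\<sigma> permutes {..<n}" for \<sigma>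
      using h that by blast
    have hB: "h \<sigma> \<in> B" if \<sigma>: "\<sigma> permutes {..<n}" for \<sigma>
    proof -
      from hE[OF that] obtain \<tau> f where \<tau>: "\<tau> permutes {..<n}" "h \<sigma> = pair_listing n q \<tau> (\<sigma> \<circ> \<tau>) f" "h \<sigma> \<in> C"
        by blast
      have "even (inv q (h \<sigma> (2 * i))) \<noteq> even (inv q (h \<sigma> (2 * i + 1)))" if "i < n" for i
        unfolding \<tau>(2) pair_listing_apply[OF q \<tau>(1) permutes_compose[OF \<tau>(1) \<sigma>] that] permutes_inverses(2)[OF q]
        by simp
      with \<tau>(3) show ?thesis by (simp add: B_def)
    qed
    have "bij_betw h ?S B"
    proof (rule bij_betw_imageI)
      show "inj_on h ?S"
      proof (rule inj_onI)
        fix \<sigma> \<sigma>' assume "\<sigma> \<in> ?S" "\<sigma>' \<in> ?S" "h \<sigma> = h \<sigma>'"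
        then show "\<sigma> = \<sigma>'"
          using hE[of \<sigma>] hE[of \<sigma>'] pair_listing_matching_unique[of \<sigma> _ \<sigma>'] by (metis mem_Collect_eq)
      qed
      show "h ` ?S = B"
      proof
        show "h ` ?S \<subseteq> B" using hB by blast
        show "B \<subseteq> h ` ?S"
        proof
          fix p assume p: "p \<in> B"
          then have "p permutes {..<2 * n}" by (simp add: B_def C_def pair_sorted_def)
          moreover have "even (inv q (p (2 * i))) \<noteq> even (inv q (p (2 * i + 1)))" if "i < n" for i
            using p that by (simp add: B_def)
          ultimately obtain \<sigma> \<tau> f
            where \<sigma>: "\<sigma> permutes {..<n}" "\<tau> permutes {..<n}" "p = pair_listing n q \<tau> (\<sigma> \<circ> \<tau>) f"
            using pair_listing_surj by blast
          \<comment> \<open>\<open>p\<close> and \<open>h \<sigma>\<close> are sorted listings of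
            the same matching, so uniqueness identifies them.\<close>
          obtain \<tau>' f' where "\<tau>' permutes {..<n}" "h \<sigma> = pair_listing n q \<tau>' (\<sigma> \<circ> \<tau>') f'" "h \<sigma> \<in> C"
            using hE[OF \<sigma>(1)] by blast
          with \<sigma> p have "p = h \<sigma>"
            using pair_sorted_listing_unique[OF \<sigma>(1,2), of \<tau>' f f'] by (simp add: B_def C_def)
          with \<sigma>(1) show "p \<in> h ` ?S" by blast
        qed
      qed
    qed
    then have "sum F B = (\<Sum>\<sigma>\<in>?S. F (h \<sigma>))" by (rule sum.reindex_bij_betw[symmetric])
    also have "\<dots> = sum ?G ?S"
    proof (rule sum.cong[OF refl])
      fix \<sigma> assume "\<sigma> \<in> ?S"
      then have \<sigma>: "\<sigma> permutes {..<n}" by simp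
      from hE[OF \<sigma>] obtain \<tau> f where \<tau>: "\<tau> permutes {..<n}" and h\<sigma>: "h \<sigma> = pair_listing n q \<tau> (\<sigma> \<circ> \<tau>) f"
        by blast
      note \<rho> = permutes_compose[OF \<tau> \<sigma>]
      \<comment> \<open>\<open>D\<close> is the total sign of the exchanges. It occurs once through
        skew symmetry of the entries and once in the sign of the listing, so it cancels.\<close>
      define D where "D = (\<Prod>i<n. if f i then - 1 else 1 :: 'a)"
      have D2: "D * D = 1" unfolding D_def prod.distrib[symmetric] by (intro prod.neutral) auto
      have "(\<Prod>i<n. A (h \<sigma> (2 * i)) (h \<sigma> (2 * i + 1))) =
          (\<Prod>i<n. (if f i then - 1 else 1) * A (q (2 * \<tau> i)) (q (2 * \<sigma> (\<tau> i) + 1)))"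
      proof (intro prod.cong refl)
        fix i assume "i \<in> {..<n}"
        then have i: "i < n" by simp
        show "A (h \<sigma> (2 * i)) (h \<sigma> (2 * i + 1)) = (if f i then - 1 else 1) * A (q (2 * \<tau> i)) (q (2 * \<sigma> (\<tau> i) + 1))"
          unfolding h\<sigma> pair_listing_apply[OF q \<tau> \<rho> i]
          using skew[of "q (2 * \<sigma> (\<tau> i) + 1)" "q (2 * \<tau> i)"] by simp
      qed
      also have "\<dots> = D * (\<Prod>i<n. A (q (2 * \<tau> i)) (q (2 * \<sigma> (\<tau> i) + 1)))"
        by (simp add: prod.distrib D_def)
      also have "(\<Prod>i<n. A (q (2 * \<tau> i)) (q (2 * \<sigma> (\<tau> i) + 1))) = (\<Prod>i<n. A (q (2 * i)) (q (2 * \<sigma> i + 1)))"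
        by (rule prod.reindex_bij_betw[OF permutes_imp_bij[OF \<tau>]])
      finally have 1: "(\<Prod>i<n. A (h \<sigma> (2 * i)) (h \<sigma> (2 * i + 1))) =
          D * (\<Prod>i<n. A (q (2 * i)) (q (2 * \<sigma> i + 1)))" .
      \<comment> \<open>\<tau> reorders the left and the right ends alike, so its sign occurs twice
        in the sign of the listing and cancels.\<close>
      have s\<rho>: "sign (\<sigma> \<circ> \<tau>) = sign \<sigma> * sign \<tau>"
        using \<sigma> \<tau> by (intro sign_compose) (auto intro: permutes_imp_permutation)
      have "sign (h \<sigma>) = sign q * sign \<sigma> * (\<Prod>i<n. if f i then - 1 else 1)"
        unfolding h\<sigma> sign_pair_listing[OF q \<tau> \<rho>] s\<rho> by (simp add: mult_ac)
      then have 2: "of_int (sign (h \<sigma>)) = of_int (sign q) * of_int (sign \<sigma>) * D"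
        by (simp add: D_def if_distrib cong: if_cong)
      show "F (h \<sigma>) = ?G \<sigma>"
        unfolding F_def 1 2 using D2 by (simp add: mult_ac) (simp add: mult.assoc[symmetric])
    qed
    finally show ?thesis .
  qed
  finally show ?thesis by (simp add: sum_distrib_left)
qed

end

section \<open>Pfaffians of orientations of complete bipartite graphs\<close>

lemma prod_single:
  "(\<Prod>i\<in>I. Poly_Mapping.single (a i) (c i)) =
     (Poly_Mapping.single (\<Sum>i\<in>I. a i) (\<Prod>i\<in>I. c i) :: 'a::comm_monoid_add \<Rightarrow>\<^sub>0 'b::comm_semiring_1)"
  by (induction I rule: infinite_finite_induct) (simp_all add: mult_single)

lemma single_sum: "Poly_Mapping.single a (\<Sum>x\<in>S. f x) = (\<Sum>x\<in>S. Poly_Mapping.single a (f x))"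
  by (induction S rule: infinite_finite_induct) (simp_all add: single_add)

text \<open>Injectivity of \<open>a\<close> makes the monomials distinct, so coefficients can be
  compared one at a time.\<close>

lemma sum_single_eq_iff:
  fixes f g :: "'a \<Rightarrow> 'b::comm_monoid_add"
  assumes "finite S" "inj_on a S"
  shows "(\<Sum>x\<in>S. Poly_Mapping.single (a x) (f x)) = (\<Sum>x\<in>S. Poly_Mapping.single (a x) (g x)) \<longleftrightarrow>
    (\<forall>x\<in>S. f x = g x)"
proof
  have *: "Poly_Mapping.lookup (\<Sum>x\<in>S. Poly_Mapping.single (a x) (f x)) (a y) = f y" if "y \<in> S" for f :: "'a \<Rightarrow> 'b" and y
  proof -
    have "Poly_Mapping.lookup (\<Sum>x\<in>S. Poly_Mapping.single (a x) (f x)) (a y) =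
        (\<Sum>x\<in>S. if x = y then f x else 0)"
      unfolding lookup_sum lookup_single
      using assms(2) that by (intro sum.cong) (auto simp: when_def dest: inj_onD)
    then show ?thesis using assms(1) that by simp
  qed
  assume "(\<Sum>x\<in>S. Poly_Mapping.single (a x) (f x)) = (\<Sum>x\<in>S. Poly_Mapping.single (a x) (g x))"
  then show "\<forall>x\<in>S. f x = g x" using * by metis
qed simp

section \<open>Perfect matchings as permutations, and their monomials\<close>

definition matching_of :: "nat \<Rightarrow> (nat \<Rightarrow> nat) \<Rightarrow> (nat + nat) set set" where
  "matching_of n \<sigma> = (\<lambda>i. {Inl i, Inr (\<sigma> i)}) ` {..<n}"

definition matching_monomial :: "nat \<Rightarrow> (nat \<Rightarrow> nat) \<Rightarrow> (nat + nat) set \<Rightarrow>\<^sub>0 nat" where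
  "matching_monomial n \<sigma> = (\<Sum>i<n. Poly_Mapping.single {Inl i, Inr (\<sigma> i)} 1)"

text \<open>The exponent of the variable of an edge tells whether the matching contains it, which
  recovers the permutation.\<close>

lemma inj_on_matching_monomial: "inj_on (matching_monomial n) {\<sigma>. \<sigma> permutes {..<n}}"
proof (rule inj_onI)
  fix \<sigma> \<sigma>' assume \<sigma>: "\<sigma> \<in> {\<sigma>. \<sigma> permutes {..<n}}" "\<sigma>' \<in> {\<sigma>. \<sigma> permutes {..<n}}"
    and eq: "matching_monomial n \<sigma> = matching_monomial n \<sigma>'"
  have *: "Poly_Mapping.lookup (matching_monomial n \<sigma>) {Inl i, Inr j} = (if \<sigma> i = j then 1 else 0)"
    if "i < n" for \<sigma> i j
  proof -
    have "Poly_Mapping.lookup (matching_monomial n \<sigma>) {Inl i, Inr j} =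
        (\<Sum>i'<n. if i' = i then if \<sigma> i = j then 1 else 0 else 0)"
      unfolding matching_monomial_def lookup_sum lookup_single
      by (intro sum.cong) (auto simp: when_def doubleton_eq_iff)
    then show ?thesis using that by simp
  qed
  show "\<sigma> = \<sigma>'"
  proof
    fix i
    show "\<sigma> i = \<sigma>' i"
    proof (cases "i < n")
      case True
      have "1 = Poly_Mapping.lookup (matching_monomial n \<sigma>) {Inl i, Inr (\<sigma> i)}"
        by (subst *[OF True]) simp
      also have "\<dots> = (if \<sigma>' i = \<sigma> i then 1 else 0)" unfolding eq by (rule *[OF True])
      finally show ?thesis by (simp split: if_splits)
    next
      case False
      then show ?thesis using \<sigma> by (simp add: permutes_not_in)
    qed
  qed
qed

text \<open>For surjectivity, the unique edge at each left vertex defines a map to the right side,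
  and uniqueness at the right vertices makes it injective.\<close>

lemma bij_betw_matching_of:
  "bij_betw (matching_of n) {\<sigma>. \<sigma> permutes {..<n}} {M. perfect_matching (complete_bipartite n n) M}"
proof (rule bij_betw_imageI)
  show "inj_on (matching_of n) {\<sigma>. \<sigma> permutes {..<n}}"
  proof (rule inj_onI)
    fix \<sigma> \<sigma>' assume \<sigma>: "\<sigma> \<in> {\<sigma>. \<sigma> permutes {..<n}}" "\<sigma>' \<in> {\<sigma>. \<sigma> permutes {..<n}}"
      and eq: "matching_of n \<sigma> = matching_of n \<sigma>'"
    show "\<sigma> = \<sigma>'"
    proof
      fix i
      show "\<sigma> i = \<sigma>' i"
      proof (cases "i < n")
        case True
        then have "{Inl i, Inr (\<sigma> i)} \<in> matching_of n \<sigma>'" unfolding eq[symmetric] by (auto simp: matching_of_def)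
        then show ?thesis by (auto simp: matching_of_def doubleton_eq_iff)
      next
        case False
        then show ?thesis using \<sigma> by (simp add: permutes_not_in)
      qed
    qed
  qed
  show "matching_of n ` {\<sigma>. \<sigma> permutes {..<n}} = {M. perfect_matching (complete_bipartite n n) M}"
  proof (intro set_eqI iffI)
    fix M assume "M \<in> matching_of n ` {\<sigma>. \<sigma> permutes {..<n}}"
    then obtain \<sigma> where \<sigma>: "\<sigma> permutes {..<n}" and M: "M = matching_of n \<sigma>" by blast
    have lt: "\<sigma> i < n" if "i < n" for i using permutes_in_image[OF \<sigma>, of i] that by simp
    have "M \<subseteq> edges (complete_bipartite n n)"
      using lt by (auto simp: M matching_of_def complete_bipartite_def)
    moreover have "\<exists>!e. e \<in> M \<and> v \<in> e" if v: "v \<in> verts (complete_bipartite n n)" for v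
    proof (cases v)
      case (Inl i)
      then have "i < n" using v by (auto simp: complete_bipartite_def)
      then show ?thesis using Inl by (intro ex1I[of _ "{Inl i, Inr (\<sigma> i)}"]) (auto simp: M matching_of_def)
    next
      case (Inr j)
      then have "j < n" using v by (auto simp: complete_bipartite_def)
      then obtain i where i: "i < n" "j = \<sigma> i"
        using permutes_image[OF \<sigma>] by (metis imageE lessThan_iff)
      then show ?thesis
        using Inr permutes_inj[OF \<sigma>]
        by (intro ex1I[of _ "{Inl i, Inr (\<sigma> i)}"]) (auto simp: M matching_of_def dest: injD)
    qed
    ultimately show "M \<in> {M. perfect_matching (complete_bipartite n n) M}"
      by (simp add: perfect_matching_def)
  next
    fix M assume "M \<in> {M. perfect_matching (complete_bipartite n n) M}"
    then have sub: "M \<subseteq> {{Inl i, Inr j} | i j. i < n \<and> j < n}"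
      and uniq: "\<And>v. v \<in> Inl ` {..<n} \<union> Inr ` {..<n} \<Longrightarrow> \<exists>!e. e \<in> M \<and> v \<in> e"
      by (auto simp: perfect_matching_def complete_bipartite_def)
    then have same: "e = e'" if "e \<in> M" "e' \<in> M" "v \<in> e" "v \<in> e'" "v \<in> Inl ` {..<n} \<union> Inr ` {..<n}" for e e' v
      using that by blast
    have "\<exists>j. j < n \<and> {Inl i, Inr j} \<in> M" if "i < n" for i
    proof -
      from uniq[of "Inl i"] that obtain e where e: "e \<in> M" "Inl i \<in> e" by auto
      with sub obtain i' j where "e = {Inl i', Inr j}" "j < n" by blast
      with e show ?thesis by auto
    qed
    then obtain g where g: "\<And>i. i < n \<Longrightarrow> g i < n \<and> {Inl i, Inr (g i)} \<in> M" by metis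
    \<comment> \<open>The extension by the identity is what \<open>permutes\<close> requires outside
      {..<n}.\<close>
    define \<sigma> where "\<sigma> i = (if i < n then g i else i)" for i
    have "\<sigma> permutes {..<n}"
    proof (rule inj_imp_permutes)
      show "inj_on \<sigma> {..<n}"
      proof (rule inj_onI)
        fix i i' assume "i \<in> {..<n}" "i' \<in> {..<n}" "\<sigma> i = \<sigma> i'"
        then have i: "i < n" "i' < n" "g i = g i'" by (auto simp: \<sigma>_def)
        then have "{Inl i, Inr (g i)} = {Inl i', Inr (g i')}"
          using g[OF i(1)] g[OF i(2)] i by (intro same[of _ _ "Inr (g i)"]) simp_all
        then show "i = i'" by (auto simp: doubleton_eq_iff)
      qed
    qed (use g in \<open>auto simp: \<sigma>_def\<close>)
    moreover have "M = matching_of n \<sigma>"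
    proof
      show "matching_of n \<sigma> \<subseteq> M" using g by (auto simp: matching_of_def \<sigma>_def)
      show "M \<subseteq> matching_of n \<sigma>"
      proof
        fix e assume e: "e \<in> M"
        with sub obtain i j where ij: "e = {Inl i, Inr j}" "i < n" by blast
        then have "e = {Inl i, Inr (g i)}" using g[OF ij(2)] ij e by (intro same[of _ _ "Inl i"]) simp_all
        then show "e \<in> matching_of n \<sigma>" using ij by (auto simp: matching_of_def \<sigma>_def)
      qed
    qed
    ultimately show "M \<in> matching_of n ` {\<sigma>. \<sigma> permutes {..<n}}" by blast
  qed
qed

lemma PM_complete_bipartite:
  "PM (complete_bipartite n n) =
     (\<Sum>\<sigma> | \<sigma> permutes {..<n}. Poly_Mapping.single (matching_monomial n \<sigma>) 1)"
proof -
  have "PM (complete_bipartite n n) = (\<Sum>\<sigma> | \<sigma> permutes {..<n}. \<Prod>e\<in>matching_of n \<sigma>. Var e)"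
    unfolding PM_def by (rule sum.reindex_bij_betw[OF bij_betw_matching_of, symmetric])
  also have "\<dots> = (\<Sum>\<sigma> | \<sigma> permutes {..<n}. Poly_Mapping.single (matching_monomial n \<sigma>) 1)"
  proof (intro sum.cong refl)
    fix \<sigma> :: "nat \<Rightarrow> nat"
    have "inj_on (\<lambda>i. {Inl i, Inr (\<sigma> i)}) {..<n}" by (rule inj_onI) (auto simp: doubleton_eq_iff)
    then show "(\<Prod>e\<in>matching_of n \<sigma>. Var e) = Poly_Mapping.single (matching_monomial n \<sigma>) 1"
      by (simp add: matching_of_def Var_def prod_single matching_monomial_def sum.reindex)
  qed
  finally show ?thesis .
qed

text \<open>\<open>q\<close> translates the alternating numbering of left and right vertices into
  positions in \<open>vs\<close>, so that an arbitrary ordering fits the bipartite Pfaffian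
  formula.\<close>

lemma vertex_ordering_position:
  assumes "vertex_ordering (complete_bipartite n n) vs"
  obtains q where "q permutes {..<2 * n}"
    "\<And>i. i < n \<Longrightarrow> vs ! q (2 * i) = Inl i" "\<And>i. i < n \<Longrightarrow> vs ! q (2 * i + 1) = Inr i"
proof -
  let ?V = "Inl ` {..<n} \<union> Inr ` {..<n}"
  have vs: "distinct vs" "set vs = ?V"
    using assms by (auto simp: vertex_ordering_def complete_bipartite_def)
  have len: "length vs = 2 * n"
    using assms card_verts_complete_bipartite[of n n] by (auto simp: vertex_ordering_def distinct_card[symmetric])
  define v where "v x = (if even x then Inl (x div 2) else Inr (x div 2) :: nat + nat)" for x
  have v: "bij_betw v {..<2 * n} ?V"
    by (rule bij_betwI[where g = "case_sum (\<lambda>i. 2 * i) (\<lambda>i. 2 * i + 1)"]) (auto simp: v_def)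
  have nth: "bij_betw ((!) vs) {..<2 * n} ?V"
    using bij_betw_nth[OF vs(1), of "{..<2 * n}" ?V] len vs(2) by simp
  define q where "q x = (if x < 2 * n then inv_into {..<2 * n} ((!) vs) (v x) else x)" for x
  have "bij_betw (inv_into {..<2 * n} ((!) vs) \<circ> v) {..<2 * n} {..<2 * n}"
    by (rule bij_betw_trans[OF v bij_betw_inv_into[OF nth]])
  then have "bij_betw q {..<2 * n} {..<2 * n}"
    by (subst bij_betw_cong[where g = "inv_into {..<2 * n} ((!) vs) \<circ> v"]) (auto simp: q_def)
  then have "q permutes {..<2 * n}" by (rule bij_imp_permutes) (simp add: q_def)
  moreover have "vs ! q x = v x" if "x < 2 * n" for x
    using that bij_betw_inv_into_right[OF nth, of "v x"] bij_betwE[OF v] by (simp add: q_def)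
  from this[of "2 * i" for i] this[of "2 * i + 1" for i]
  have "vs ! q (2 * i) = Inl i" "vs ! q (2 * i + 1) = Inr i" if "i < n" for i
    using that by (simp_all add: v_def)
  ultimately show thesis by (rule that)
qed

text \<open>For an orientation of the complete bipartite graph and an edge of it, the value -1 means
  the arc from right to left.\<close>

definition arc_sign :: "(('a + 'b) \<times> ('a + 'b)) set \<Rightarrow> 'a \<Rightarrow> 'b \<Rightarrow> real" where
  "arc_sign D i j = (if (Inl i, Inr j) \<in> D then 1 else - 1)"

text \<open>Entries within one side vanish because there are no such edges, and an entry between the
  sides is a signed variable. The determinant expansion therefore has one signed monomial per
  matching.\<close>

lemma pfaffian_skew_adjacency:
  assumes q: "q permutes {..<2 * n}"
    and pos: "\<And>i. i < n \<Longrightarrow> vs ! q (2 * i) = Inl i" "\<And>i. i < n \<Longrightarrow> vs ! q (2 * i + 1) = Inr i"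
    and D: "orientation (complete_bipartite n n) D"
  shows "pfaffian n (skew_adjacency vs D) =
    (\<Sum>\<sigma> | \<sigma> permutes {..<n}. Poly_Mapping.single (matching_monomial n \<sigma>)
       (of_int (sign q) * of_int (sign \<sigma>) * (\<Prod>i<n. arc_sign D i (\<sigma> i))))"
proof -
  let ?E = "{{Inl i, Inr j} | i j. i < n \<and> j < n} :: (nat + nat) set set"
  have arcs: "{u, v} \<in> ?E" if "(u, v) \<in> D" for u v
    using D that by (auto simp: orientation_def complete_bipartite_def)
  have orient: "((u, v) \<in> D) \<noteq> ((v, u) \<in> D)" if "{u, v} \<in> ?E" for u v
    using D that unfolding orientation_def complete_bipartite_def snd_conv by blast
  have entry: "skew_adjacency vs D (q (2 * i)) (q (2 * j + 1)) =
      Poly_Mapping.single (Poly_Mapping.single {Inl i, Inr j} 1) (arc_sign D i j)" if "i < n" "j < n" for i j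
  proof -
    have "{Inl i, Inr j} \<in> ?E" using that by blast
    from orient[OF this] show ?thesis
      using that by (auto simp: skew_adjacency_def pos[simplified] arc_sign_def Var_def single_uminus)
  qed
  have "pfaffian n (skew_adjacency vs D) = of_int (sign q) * (\<Sum>\<sigma> | \<sigma> permutes {..<n}.
      of_int (sign \<sigma>) * (\<Prod>i<n. skew_adjacency vs D (q (2 * i)) (q (2 * \<sigma> i + 1))))"
  proof (rule pfaffian_bipartite[OF q])
    fix i j
    show "skew_adjacency vs D j i = - skew_adjacency vs D i j"
      using arcs[of "vs ! i" "vs ! j"] orient[of "vs ! i" "vs ! j"]
      by (auto simp: skew_adjacency_def insert_commute)
  next
    fix i j assume "i < n" "j < n"
    then show "skew_adjacency vs D (q (2 * i)) (q (2 * j)) = 0"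
        "skew_adjacency vs D (q (2 * i + 1)) (q (2 * j + 1)) = 0"
      using arcs[of "Inl i" "Inl j"] arcs[of "Inl j" "Inl i"] arcs[of "Inr i" "Inr j"] arcs[of "Inr j" "Inr i"]
      unfolding skew_adjacency_def by (auto simp: pos[simplified] doubleton_eq_iff)
  qed
  also have "\<dots> = of_int (sign q) * (\<Sum>\<sigma> | \<sigma> permutes {..<n}.
      of_int (sign \<sigma>) * Poly_Mapping.single (matching_monomial n \<sigma>) (\<Prod>i<n. arc_sign D i (\<sigma> i)))"
  proof -
    have "(\<Prod>i<n. skew_adjacency vs D (q (2 * i)) (q (2 * \<sigma> i + 1))) =
        Poly_Mapping.single (matching_monomial n \<sigma>) (\<Prod>i<n. arc_sign D i (\<sigma> i))" if "\<sigma> permutes {..<n}" for \<sigma>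
    proof -
      have "\<sigma> i < n" if "i < n" for i using permutes_in_image[OF \<open>\<sigma> permutes _\<close>, of i] that by simp
      then show ?thesis
        unfolding matching_monomial_def prod_single[symmetric]
        by (intro prod.cong refl entry) auto
    qed
    then show ?thesis by simp
  qed
  also have "\<dots> = (\<Sum>\<sigma> | \<sigma> permutes {..<n}. Poly_Mapping.single (matching_monomial n \<sigma>)
       (of_int (sign q) * of_int (sign \<sigma>) * (\<Prod>i<n. arc_sign D i (\<sigma> i))))"
    \<comment> \<open>The integer signs are constant polynomials and merge into the coefficient of
      the monomial.\<close>
    unfolding sum_distrib_left
    by (intro sum.cong refl) (simp add: single_of_int[symmetric] mult_single mult.assoc del: single_of_int)
  finally show ?thesis .
qed

text \<open>Entry \<open>s l i j\<close> is \<open>1\<close> exactly when the \<open>l\<close>-th orientation directs \<open>Inl i\<close> to \<open>Inr j\<close>.\<close>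

definition sign_span :: "nat \<Rightarrow> nat \<Rightarrow> bool" where
  "sign_span n k \<longleftrightarrow> (\<exists>(s :: nat \<Rightarrow> nat \<Rightarrow> nat \<Rightarrow> real) c.
     (\<forall>l<k. \<forall>i<n. \<forall>j<n. s l i j \<in> {1, - 1}) \<and>
     (\<forall>\<sigma>. \<sigma> permutes {..<n} \<longrightarrow> (\<Sum>l<k. c l * (\<Prod>i<n. s l i (\<sigma> i))) = of_int (sign \<sigma>)))"

lemma real_sign_sq: "real_of_int (sign p) * real_of_int (sign p) = 1"
  by (simp flip: of_int_mult)

text \<open>Coefficients are compared monomial by monomial. The forward direction carries the lower
  bound; the backward direction makes the minimum exist.\<close>

lemma k_pfaffian_iff_sign_span:
  assumes vs: "vertex_ordering (complete_bipartite n n) vs"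
  shows "k_pfaffian vs (complete_bipartite n n) k \<longleftrightarrow> sign_span n k"
proof -
  let ?G = "complete_bipartite n n" and ?S = "{\<sigma>. \<sigma> permutes {..<n}}"
  obtain q where q: "q permutes {..<2 * n}"
    and pos: "\<And>i. i < n \<Longrightarrow> vs ! q (2 * i) = Inl i" "\<And>i. i < n \<Longrightarrow> vs ! q (2 * i + 1) = Inr i"
    using vertex_ordering_position[OF vs] by blast
  have len: "length vs div 2 = n"
    using vs card_verts_complete_bipartite[of n n] by (auto simp: vertex_ordering_def distinct_card[symmetric])
  have expand: "PM ?G = (\<Sum>l<k. Const (c l) * pfaffian (length vs div 2) (skew_adjacency vs (D l))) \<longleftrightarrow>
      (\<forall>\<sigma>. \<sigma> permutes {..<n} \<longrightarrow>
        (\<Sum>l<k. (of_int (sign q) * c l) * (\<Prod>i<n. arc_sign (D l) i (\<sigma> i))) = of_int (sign \<sigma>))"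
    if D: "\<forall>l<k. orientation ?G (D l)" for D and c :: "nat \<Rightarrow> real"
  proof -
    have "(\<Sum>l<k. Const (c l) * pfaffian (length vs div 2) (skew_adjacency vs (D l))) =
      (\<Sum>l<k. \<Sum>\<sigma>\<in>?S. Poly_Mapping.single (matching_monomial n \<sigma>)
        (c l * (of_int (sign q) * of_int (sign \<sigma>) * (\<Prod>i<n. arc_sign (D l) i (\<sigma> i)))))"
      using D by (intro sum.cong refl)
        (simp add: len pfaffian_skew_adjacency[OF q pos] Const_def sum_distrib_left mult_single)
    also have "\<dots> = (\<Sum>\<sigma>\<in>?S. Poly_Mapping.single (matching_monomial n \<sigma>)
        (\<Sum>l<k. c l * (of_int (sign q) * of_int (sign \<sigma>) * (\<Prod>i<n. arc_sign (D l) i (\<sigma> i)))))"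
      unfolding single_sum by (rule sum.swap)
    also have "\<dots> = (\<Sum>\<sigma>\<in>?S. Poly_Mapping.single (matching_monomial n \<sigma>)
        (of_int (sign \<sigma>) * (\<Sum>l<k. (of_int (sign q) * c l) * (\<Prod>i<n. arc_sign (D l) i (\<sigma> i)))))"
      unfolding sum_distrib_left by (simp add: mult_ac)
    finally have eq: "(\<Sum>l<k. Const (c l) * pfaffian (length vs div 2) (skew_adjacency vs (D l))) =
      (\<Sum>\<sigma>\<in>?S. Poly_Mapping.single (matching_monomial n \<sigma>)
        (of_int (sign \<sigma>) * (\<Sum>l<k. (of_int (sign q) * c l) * (\<Prod>i<n. arc_sign (D l) i (\<sigma> i)))))" .
    \<comment> \<open>Each coefficient of \<open>PM\<close> is 1; the sign is its own inverse and
      moves to the other side.\<close>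
    have flip: "1 = of_int (sign \<sigma>) * x \<longleftrightarrow> x = of_int (sign \<sigma>)" for \<sigma> :: "nat \<Rightarrow> nat" and x :: real
      by (cases \<sigma> rule: sign_cases) auto
    show ?thesis
      unfolding eq PM_complete_bipartite
      by (subst sum_single_eq_iff) (auto simp: finite_permutations inj_on_matching_monomial flip)
  qed
  show ?thesis
  proof
    assume "k_pfaffian vs ?G k"
    then obtain D c where D: "\<forall>l<k. orientation ?G (D l)"
      and "PM ?G = (\<Sum>l<k. Const (c l) * pfaffian (length vs div 2) (skew_adjacency vs (D l)))"
      by (auto simp: k_pfaffian_def)
    then show "sign_span n k"
      unfolding sign_span_def expand[OF D]
      by (intro exI[of _ "\<lambda>l. arc_sign (D l)"] exI[of _ "\<lambda>l. of_int (sign q) * c l"]) (simp add: arc_sign_def)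
  next
    assume "sign_span n k"
    then obtain s c where s: "\<forall>l<k. \<forall>i<n. \<forall>j<n. s l i j \<in> {1, - 1 :: real}"
      and sc: "\<forall>\<sigma>. \<sigma> permutes {..<n} \<longrightarrow> (\<Sum>l<k. c l * (\<Prod>i<n. s l i (\<sigma> i))) = of_int (sign \<sigma>)"
      unfolding sign_span_def by (elim exE conjE)
    define D where "D l = {(Inl i, Inr j) | i j. i < n \<and> j < n \<and> s l i j = 1} \<union>
      {(Inr j, Inl i) | i j. i < n \<and> j < n \<and> s l i j \<noteq> 1}" for l
    have D: "\<forall>l<k. orientation ?G (D l)"
      by (auto simp: orientation_def complete_bipartite_def D_def doubleton_eq_iff)
    have arc: "arc_sign (D l) i j = s l i j" if "l < k" "i < n" "j < n" for l i j
      using s[rule_format, OF that] that by (auto simp: arc_sign_def D_def)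
    \<comment> \<open>The common sign of the vertex ordering squares to 1, so it can be absorbed
      into the coefficients.\<close>
    define c' where "c' l = of_int (sign q) * c l" for l
    have c': "of_int (sign q) * c' l = c l" for l
      by (simp add: c'_def real_sign_sq mult.assoc[symmetric])
    have "PM ?G = (\<Sum>l<k. Const (c' l) * pfaffian (length vs div 2) (skew_adjacency vs (D l)))"
      unfolding expand[OF D]
    proof (intro allI impI)
      fix \<sigma> assume \<sigma>: "\<sigma> permutes {..<n}"
      have lt: "\<sigma> i < n" if "i < n" for i using permutes_in_image[OF \<sigma>, of i] that by simp
      have "(\<Sum>l<k. (of_int (sign q) * c' l) * (\<Prod>i<n. arc_sign (D l) i (\<sigma> i))) =
          (\<Sum>l<k. c l * (\<Prod>i<n. s l i (\<sigma> i)))"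
        unfolding c' by (intro sum.cong arg_cong2[where f = "(*)"] prod.cong refl arc lt) auto
      then show "(\<Sum>l<k. (of_int (sign q) * c' l) * (\<Prod>i<n. arc_sign (D l) i (\<sigma> i))) = of_int (sign \<sigma>)"
        using sc \<sigma> by simp
    qed
    with D show "k_pfaffian vs ?G k" unfolding k_pfaffian_def by blast
  qed
qed

section \<open>The lower bound\<close>

lemma sign_span_lower_bound:
  assumes "sign_span n k" and mn: "3 * m \<le> n"
  shows "32 ^ m \<le> k * 12 ^ m"
proof -
  from assms(1) obtain s c where s: "\<forall>l<k. \<forall>i<n. \<forall>j<n. s l i j \<in> {1, - 1 :: real}"
    and sc: "\<forall>\<sigma>. \<sigma> permutes {..<n} \<longrightarrow> (\<Sum>l<k. c l * (\<Prod>i<n. s l i (\<sigma> i))) = of_int (sign \<sigma>)"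
    unfolding sign_span_def by (elim exE conjE)
  define T where "T = {t. t permutes {..<3::nat}}"
  \<comment> \<open>This is the contribution of block \<open>j\<close> to summand \<open>l\<close>
    after multiplication by the sign function.\<close>
  define w where "w l j t = of_int (sign t) * (\<Prod>a<3. s l (3 * j + a) (3 * j + t a))" for l j t
  define U where "U l j = {t \<in> T. w l j t = - 1}" for l j
  have finT: "finite T" by (simp add: T_def finite_permutations)
  have cardT: "card T = 6"
    using card_permutations[of "{..<3::nat}" 3] by (simp add: T_def eval_nat_numeral)
  have entry: "s l (3 * j + a) (3 * j + b) \<in> {1, - 1}" if "l < k" "j < m" "a < 3" "b < 3" for l j a b
    using s[rule_format, of l "3 * j + a" "3 * j + b"] that mn by linarith
  have w_sign: "w l j t = set_sign (U l j) t" if "l < k" "j < m" "t \<in> T" for l j t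
  proof -
    have "t a < 3" if "a < 3" for a
      using permutes_in_image[of t "{..<3}" a] \<open>t \<in> T\<close> that by (simp add: T_def)
    then have "\<bar>s l (3 * j + a) (3 * j + t a)\<bar> = 1" if "a < 3" for a
      using entry[OF \<open>l < k\<close> \<open>j < m\<close> that, of "t a"] that by auto
    then have "\<bar>w l j t\<bar> = 1"
      by (cases t rule: sign_cases) (simp_all add: w_def abs_mult abs_prod)
    then show ?thesis using \<open>t \<in> T\<close> by (auto simp: set_sign_def U_def abs_if split: if_splits)
  qed
  have odd_U: "odd (card (U l j))" if "l < k" "j < m" for l j
  proof -
    have "(- 1) ^ card (U l j) = (\<Prod>t\<in>T. set_sign (U l j) t)"
      using finT by (subst prod_set_sign) (auto simp: U_def)
    also have "\<dots> = (\<Prod>t\<in>T. w l j t)" using that by (intro prod.cong) (simp_all add: w_sign)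
    also have "\<dots> = - 1"
      unfolding T_def w_def using entry[OF that] by (intro prod_permutations_3) blast
    finally show ?thesis by (auto simp: minus_one_power_iff split: if_splits)
  qed
  \<comment> \<open>Block permutations fix the indices from 3 * m on. These rows give a factor
    independent of \<open>t\<close>, which joins the coefficient \<open>c l\<close>.\<close>
  define d where "d l = (\<Prod>i\<in>{3 * m..<n}. s l i i)" for l
  have "(\<Sum>l<k. (c l * d l) * (\<Prod>j<m. set_sign (U l j) (t j))) = 1" if t: "t \<in> PiE {..<m} (\<lambda>_. T)" for t
  proof -
    have tp: "t j permutes {..<3}" if "j < m" for j using t that by (auto simp: T_def)
    define \<sigma> where "\<sigma> = block_perm 3 m t"
    have "\<sigma> permutes {..<3 * m}" unfolding \<sigma>_def using tp by (intro block_perm_permutes)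
    then have \<sigma>: "\<sigma> permutes {..<n}" by (rule permutes_subset) (use mn in auto)
    have sgn: "sign \<sigma> = (\<Prod>j<m. sign (t j))" unfolding \<sigma>_def using tp by (intro sign_block_perm)
    have split: "{..<n} = {..<3 * m} \<union> {3 * m..<n}" using mn by auto
    have blocks: "(\<Prod>i<n. s l i (\<sigma> i)) =
        d l * (\<Prod>j<m. \<Prod>a<3. s l (3 * j + a) (3 * j + t j a))" for l
    proof -
      have "(\<Prod>i<n. s l i (\<sigma> i)) = (\<Prod>i<3 * m. s l i (\<sigma> i)) * (\<Prod>i\<in>{3 * m..<n}. s l i (\<sigma> i))"
        unfolding split by (rule prod.union_disjoint) auto
      also have "(\<Prod>i\<in>{3 * m..<n}. s l i (\<sigma> i)) = d l"
        by (simp add: d_def \<sigma>_def block_perm_def)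
      also have "(\<Prod>i<3 * m. s l i (\<sigma> i)) = (\<Prod>j<m. \<Prod>i\<in>{j * 3..<j * 3 + 3}. s l i (\<sigma> i))"
        by (simp add: prod.nat_group mult.commute)
      also have "\<dots> = (\<Prod>j<m. \<Prod>a<3. s l (3 * j + a) (3 * j + t j a))"
      proof (rule prod.cong[OF refl])
        fix j assume "j \<in> {..<m}"
        then have j: "j < m" by simp
        have "(\<Prod>i\<in>{j * 3..<j * 3 + 3}. s l i (\<sigma> i)) = (\<Prod>a<3. s l (3 * j + a) (\<sigma> (3 * j + a)))"
          using prod.shift_bounds_nat_ivl[of "\<lambda>i. s l i (\<sigma> i)" 0 "j * 3" 3]
          by (simp add: atLeast0LessThan ac_simps)
        also have "\<dots> = (\<Prod>a<3. s l (3 * j + a) (3 * j + t j a))"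
          using j by (intro prod.cong refl) (simp add: \<sigma>_def block_perm_apply)
        finally show "(\<Prod>i\<in>{j * 3..<j * 3 + 3}. s l i (\<sigma> i)) = \<dots>" .
      qed
      finally show ?thesis by (simp only: mult.commute)
    qed
    have "(\<Prod>j<m. set_sign (U l j) (t j)) =
        of_int (sign \<sigma>) * (\<Prod>j<m. \<Prod>a<3. s l (3 * j + a) (3 * j + t j a))" if "l < k" for l
    proof -
      have "(\<Prod>j<m. set_sign (U l j) (t j)) = (\<Prod>j<m. w l j (t j))"
        using that tp by (intro prod.cong refl w_sign[symmetric]) (auto simp: T_def)
      then show ?thesis by (simp add: w_def prod.distrib sgn)
    qed
    then have "(\<Sum>l<k. (c l * d l) * (\<Prod>j<m. set_sign (U l j) (t j))) =
        (\<Sum>l<k. of_int (sign \<sigma>) * (c l * (\<Prod>i<n. s l i (\<sigma> i))))"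
      by (intro sum.cong refl) (simp add: blocks mult_ac)
    also have "\<dots> = of_int (sign \<sigma>) * of_int (sign \<sigma>)"
      using sc \<sigma> by (simp add: sum_distrib_left[symmetric])
    finally show ?thesis by (simp only: real_sign_sq)
  qed
  then show ?thesis
    by (intro odd_sign_tensor_bound[OF cardT, where U = U]) (auto simp: odd_U, auto simp: U_def)
qed

text \<open>Over all sign matrices \<open>x\<close>, the products \<open>\<Prod>i<n. x (i, \<sigma> i)\<close> are orthonormal random
  variables for distinct \<open>\<sigma>\<close>, so weighting each \<open>x\<close> by its determinant recovers the sign.\<close>

lemma sign_span_exists: "\<exists>k>0. sign_span n k"
proof -
  let ?E = "{..<n} \<times> {..<n}" and ?S = "{\<sigma>. \<sigma> permutes {..<n}}"
  define X where "X = PiE ?E (\<lambda>_. {1, - 1 :: real})"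
  define P where "P x \<sigma> = (\<Prod>i<n. x (i, \<sigma> i))" for x :: "nat \<times> nat \<Rightarrow> real" and \<sigma> :: "nat \<Rightarrow> nat"
  have finX: "finite X" by (auto simp: X_def intro!: finite_PiE)
  \<comment> \<open>This makes the number of summands positive.\<close>
  have "X \<noteq> {}" by (auto simp: X_def PiE_eq_empty_iff)
  \<comment> \<open>Padding with factors 1 gives a product over all positions, so that the sum over
    \<open>X\<close> factors position by position.\<close>
  have P: "P x \<sigma> = (\<Prod>e\<in>?E. if snd e = \<sigma> (fst e) then x e else 1)" if \<sigma>: "\<sigma> permutes {..<n}" for x \<sigma>
  proof -
    have "\<sigma> i < n" if "i < n" for i using permutes_in_image[OF \<sigma>, of i] that by simp
    then have "(\<Prod>i<n. \<Prod>j<n. if j = \<sigma> i then x (i, j) else 1) = P x \<sigma>"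
      unfolding P_def by (intro prod.cong refl) simp
    moreover have "(\<Prod>i<n. \<Prod>j<n. if j = \<sigma> i then x (i, j) else 1) =
        (\<Prod>e\<in>?E. if snd e = \<sigma> (fst e) then x e else 1)"
      unfolding prod.cartesian_product by (intro prod.cong) auto
    ultimately show ?thesis by (simp only:)
  qed
  have orth: "(\<Sum>x\<in>X. P x \<tau> * P x \<sigma>) = (if \<tau> = \<sigma> then 2 ^ card ?E else 0)"
    if \<tau>: "\<tau> permutes {..<n}" and \<sigma>: "\<sigma> permutes {..<n}" for \<tau> \<sigma>
  proof -
    define g where "g e y = (if snd e = \<tau> (fst e) then y else 1) * (if snd e = \<sigma> (fst e) then y else 1)"
      for e :: "nat \<times> nat" and y :: real
    have "(\<Sum>x\<in>X. P x \<tau> * P x \<sigma>) = (\<Sum>x\<in>X. \<Prod>e\<in>?E. g e (x e))"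
      by (simp add: P \<tau> \<sigma> g_def prod.distrib)
    also have "\<dots> = (\<Prod>e\<in>?E. \<Sum>y\<in>{1, - 1}. g e y)"
      unfolding X_def by (rule prod_sum_PiE[symmetric]) auto
    \<comment> \<open>A position on both graphs contributes \<open>y * y\<close> and one on neither
      contributes 1, with sum 2 over both signs. A position on exactly one graph contributes
      \<open>y\<close>, with sum 0.\<close>
    also have "\<dots> = (\<Prod>e\<in>?E. if (snd e = \<tau> (fst e)) = (snd e = \<sigma> (fst e)) then 2 else 0)"
      by (intro prod.cong refl) (auto simp: g_def)
    also have "\<dots> = (if \<tau> = \<sigma> then 2 ^ card ?E else 0)"
    proof (cases "\<tau> = \<sigma>")
      case False
      then obtain i where i: "\<tau> i \<noteq> \<sigma> i" by auto
      then have "i < n" using \<tau> \<sigma> by (metis lessThan_iff permutes_not_in)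
      moreover have "\<tau> i < n" using permutes_in_image[OF \<tau>, of i] \<open>i < n\<close> by simp
      ultimately have "(i, \<tau> i) \<in> ?E" by simp
      then have "(\<Prod>e\<in>?E. if (snd e = \<tau> (fst e)) = (snd e = \<sigma> (fst e)) then 2 else 0 :: real) = 0"
        using i by (intro prod_zero) (auto intro!: bexI[of _ "(i, \<tau> i)"])
      with False show ?thesis by simp
    qed simp
    finally show ?thesis .
  qed
  \<comment> \<open>\<open>C x\<close> is the determinant of \<open>x\<close> divided by the common
    squared norm of the functions \<open>P\<close>.\<close>
  define C where "C x = (\<Sum>\<tau>\<in>?S. of_int (sign \<tau>) * P x \<tau>) / 2 ^ card ?E" for x
  have span: "(\<Sum>x\<in>X. C x * P x \<sigma>) = of_int (sign \<sigma>)" if \<sigma>: "\<sigma> permutes {..<n}" for \<sigma>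
  proof -
    have "(\<Sum>x\<in>X. C x * P x \<sigma>) = (\<Sum>x\<in>X. \<Sum>\<tau>\<in>?S. of_int (sign \<tau>) * (P x \<tau> * P x \<sigma>) / 2 ^ card ?E)"
      unfolding C_def sum_divide_distrib sum_distrib_right by (simp add: mult.assoc)
    also have "\<dots> = (\<Sum>\<tau>\<in>?S. of_int (sign \<tau>) * (\<Sum>x\<in>X. P x \<tau> * P x \<sigma>) / 2 ^ card ?E)"
      by (subst sum.swap) (simp add: sum_divide_distrib sum_distrib_left)
    also have "\<dots> = (\<Sum>\<tau>\<in>?S. if \<tau> = \<sigma> then of_int (sign \<tau>) else 0)"
      using \<sigma> by (intro sum.cong refl) (simp add: orth)
    also have "\<dots> = of_int (sign \<sigma>)" using \<sigma> by (simp add: finite_permutations)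
    finally show ?thesis .
  qed
  obtain h where h: "bij_betw h {..<card X} X"
    using ex_bij_betw_nat_finite[OF finX] by (auto simp: atLeast0LessThan)
  have "sign_span n (card X)"
    unfolding sign_span_def
  proof (intro exI[of _ "\<lambda>l i j. h l (i, j)"] exI[of _ "C \<circ> h"] conjI allI impI)
    fix l i j assume "l < card X" "i < n" "j < n"
    then show "h l (i, j) \<in> {1, - 1}" using bij_betwE[OF h] by (auto simp: X_def PiE_iff)
  next
    fix \<sigma> assume \<sigma>: "\<sigma> permutes {..<n}"
    show "(\<Sum>l<card X. (C \<circ> h) l * (\<Prod>i<n. h l (i, \<sigma> i))) = of_int (sign \<sigma>)"
      using sum.reindex_bij_betw[OF h, of "\<lambda>x. C x * P x \<sigma>"] span[OF \<sigma>] by (simp add: P_def)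
  qed
  with finX \<open>X \<noteq> {}\<close> show ?thesis by (metis card_gt_0_iff)
qed

theorem theorem1p2:
  fixes n :: nat and vs :: "(nat + nat) list"
  assumes "n \<ge> 3"
    and "vertex_ordering (complete_bipartite n n) vs"
  shows "int (pfaffian_number vs (complete_bipartite n n)) \<ge> \<lceil>(8 / 3 :: real) ^ (n div 3)\<rceil>"
proof -
  let ?m = "n div 3" and ?k = "pfaffian_number vs (complete_bipartite n n)"
  \<comment> \<open>Existence ensures that \<open>LEAST\<close> returns a number with the defining
    property.\<close>
  have "\<exists>k>0. k_pfaffian vs (complete_bipartite n n) k"
    using sign_span_exists k_pfaffian_iff_sign_span[OF assms(2)] by simp
  then have "0 < ?k \<and> k_pfaffian vs (complete_bipartite n n) ?k"
    unfolding pfaffian_number_def by (rule LeastI_ex)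
  then have "sign_span n ?k" using k_pfaffian_iff_sign_span[OF assms(2)] by simp
  then have "32 ^ ?m \<le> ?k * 12 ^ ?m" by (rule sign_span_lower_bound) simp
  then have "real (32 ^ ?m) \<le> real (?k * 12 ^ ?m)" by (simp only: of_nat_le_iff)
  then have "(32::real) ^ ?m \<le> real ?k * 12 ^ ?m"
    by (simp only: of_nat_power of_nat_mult of_nat_numeral)
  \<comment> \<open>The base is the ratio 32 / 12 of all test functions to those a factor can
    detect.\<close>
  moreover have "(8 / 3 :: real) ^ ?m * 12 ^ ?m = 32 ^ ?m"
    by (simp flip: power_mult_distrib)
  ultimately have "(8 / 3 :: real) ^ ?m * 12 ^ ?m \<le> real ?k * 12 ^ ?m" by simp
  then have "(8 / 3 :: real) ^ ?m \<le> real ?k" by (rule mult_right_le_imp_le) simp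
  then show ?thesis by (simp add: ceiling_le_iff)
qed

end
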